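(* Let $X_0,X_1$ be Banach spaces such that $X_0$ is continuously embedded into $X_1$, with $\|a\|_{X_1}\le N_{X_0,X_1}\|a\|_{X_0}$ for all $a\in X_0$. Let $T\in(0,\infty)$, $p\in(1,\infty)$, $w\in A_p$, $W(t):=\int_0^tw(s)\,\mathrm{d}s$, let $\kappa:\mathbb{R}_+\to\mathbb{R}_+$ be right-continuous and decreasing with $\kappa\in\mathcal{I}_o(-1,0)$, and assume $W\circ\kappa^{*}\in\mathcal{I}_o(0,p)$. Suppose $u\in L_p((0,T),w\,\mathrm{d}t;X_0)$, $f\in L_p((0,T),w\,\mathrm{d}t;X_1)$ and, for some $u_0\in X_1\,(=X_0+X_1)$, $$\int_0^t\kappa(t-s)\,(u(s)-u_0)\,\mathrm{d}s=\int_0^tf(s)\,\mathrm{d}s\qquad\text{for }t\in(0,T).$$ Then $u_0\in(X_0,X_1)_{(W\circ\kappa^{*})^{1/p},p}$ and $$\|u_0\|_{(X_0,X_1)_{(W\circ\kappa^{*})^{1/p},p}}\le N\left(\|u\|_{L_p((0,T),w\,\mathrm{d}t;X_0)}+\|f\|_{L_p((0,T),w\,\mathrm{d}t;X_1)}\right),$$ where $N=N(p,[w]_{A_p},\kappa,N_{X_0,X_1},T)$, that is, $N$ depends only on $p$, $[w]_{A_p}$, $\kappa$, $N_{X_0,X_1}$ and $T$.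
   Context: $\mathbb{R}_+=(0,\infty)$; "decreasing" means nonincreasing. For $\phi:\mathbb{R}_+\to\mathbb{R}_+$ put $s_\phi(\lambda):=\sup_{t>0}\phi(\lambda t)/\phi(t)\in(0,\infty]$. For $a,b\in\mathbb{R}$, $\mathcal{I}_o(a,b)$ is the set of $\phi$ with $s_\phi(\lambda)=o(\lambda^a)$ as $\lambda\to0$ and $s_\phi(\lambda)=o(\lambda^b)$ as $\lambda\to\infty$. $\kappa^{*}(t):=\kappa^{-1}(1/t)$, where $\kappa^{-1}(\lambda):=\inf\{s>0:\kappa(s)\le\lambda\}$ is the generalized inverse (the assumption $\kappa\in\mathcal{I}_o(-1,0)$ forces $\kappa(0+)=\infty$, $\kappa(\infty)=0$, $\int_0^1\kappa(s)\,\mathrm{d}s<\infty$). $X_0+X_1$ is the Banach space with norm $\|a\|_{X_0+X_1}=\inf\{\|a_0\|_{X_0}+\|a_1\|_{X_1}: a=a_0+a_1,\ a_i\in X_i\}$. $A_p=A_p(\mathbb{R})$, $p\in(1,\infty)$: the set of measurable $w:\mathbb{R}\to[0,\infty)$ (as usual, positive a.e.) with $[w]_{A_p}:=\sup_{[a,b]\subset\mathbb{R}}\big(\frac1{b-a}\int_a^b w\,\mathrm{d}t\big)\big(\frac1{b-a}\int_a^b w^{-\frac1{p-1}}\,\mathrm{d}t\big)^{p-1}<\infty$. $L_p((0,T),w\,\mathrm{d}t;X)$: $X$-valued measurable functions on $(0,T)$ with $\|f\|^p=\int_0^T\|f(t)\|_X^pw(t)\,\mathrm{d}t<\infty$. $K(t,a;X_0,X_1)=\inf\{\|a_0\|_{X_0}+t\|a_1\|_{X_1}:a=a_0+a_1,\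 a_i\in X_i\}$. For $\phi\in\mathcal{I}_o(0,1)$, $(X_0,X_1)_{\phi,p}$ is the set of $a\in X_0+X_1$ with $$\|a\|_{(X_0,X_1)_{\phi,p}}:=\Big(\int_0^\infty\big(\phi(t^{-1})K(t,a;X_0,X_1)\big)^p\frac{\mathrm{d}t}{t}\Big)^{1/p}<\infty .$$ (If $W\circ\kappa^*\in\mathcal{I}_o(0,p)$ then $(W\circ\kappa^* )^{1/p}\in\mathcal{I}_o(0,1)$.)
   Formalization: N may depend, besides p, [w]_{A_p}, κ, N_{X_0,X_1}, T, also on the function s_{W∘κ*}; without this the claim fails: X_0=X_1=ℝ, T=1, p=2, κ=t^{-1/2}, u=u_0=1, f=0, w=|t|^{γ-1} (rescaled on t<0 to fix [w]_{A_2}), γ→1. *)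

theory Defs
  imports "HOL-Analysis.Analysis"
begin

section \<open>Banach spaces on explicit carriers\<close>

text \<open>
  A Banach space is a linear subspace \<open>X\<close> of an ambient real vector space together with a complete
  norm \<open>n\<close> on \<open>X\<close>; the values of \<open>n\<close> outside \<open>X\<close> are irrelevant.  Carriers are used instead of the
  class \<open>banach\<close> so that one can quantify over Banach spaces inside a formula, which is needed to
  express that a constant does not depend on the spaces.
\<close>

definition norm_on :: "'v::real_vector set \<Rightarrow> ('v \<Rightarrow> real) \<Rightarrow> bool" where
  "norm_on X n \<longleftrightarrow> subspace X \<and>
     (\<forall>x\<in>X. 0 \<le> n x) \<and>
     (\<forall>x\<in>X. n x = 0 \<longleftrightarrow> x = 0) \<and>
     (\<forall>c. \<forall>x\<in>X. n (c *\<^sub>R x) = \<bar>c\<bar> * n x) \<and>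
     (\<forall>x\<in>X. \<forall>y\<in>X. n (x + y) \<le> n x + n y)"

definition complete_norm_on :: "'v::real_vector set \<Rightarrow> ('v \<Rightarrow> real) \<Rightarrow> bool" where
  "complete_norm_on X n \<longleftrightarrow>
     (\<forall>\<xi> :: nat \<Rightarrow> 'v. range \<xi> \<subseteq> X \<longrightarrow>
        (\<forall>e>0. \<exists>m. \<forall>i\<ge>m. \<forall>j\<ge>m. n (\<xi> i - \<xi> j) < e) \<longrightarrow>
        (\<exists>x\<in>X. (\<lambda>i. n (\<xi> i - x)) \<longlonglongrightarrow> 0))"

definition banach_on :: "'v::real_vector set \<Rightarrow> ('v \<Rightarrow> real) \<Rightarrow> bool" where
  "banach_on X n \<longleftrightarrow> norm_on X n \<and> complete_norm_on X n"


section \<open>Vector-valued measurability and the Bochner integral\<close>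

text \<open>
  Strong (Bochner) measurability and the Bochner integral for functions with values in a carrier
  Banach space.  The second definition is \<^const>\<open>has_bochner_integral\<close> with the given norm in place of
  the class norm (and no separability assumption on the space).
\<close>

definition strongly_measurable_on ::
  "'v::real_vector set \<Rightarrow> ('v \<Rightarrow> real) \<Rightarrow> 'a measure \<Rightarrow> ('a \<Rightarrow> 'v) \<Rightarrow> bool" where
  "strongly_measurable_on X n M f \<longleftrightarrow> f \<in> space M \<rightarrow> X \<and>
     (\<exists>s :: nat \<Rightarrow> 'a \<Rightarrow> 'v. (\<forall>i. simple_function M (s i) \<and> s i \<in> space M \<rightarrow> X) \<and>
        (AE t in M. (\<lambda>i. n (f t - s i t)) \<longlonglongrightarrow> 0))"

definition has_bochner_integral_on ::
  "'v::real_vector set \<Rightarrow> ('v \<Rightarrow> real) \<Rightarrow> 'a measure \<Rightarrow> ('a \<Rightarrow> 'v) \<Rightarrow> 'v \<Rightarrow> bool" where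
  "has_bochner_integral_on X n M f x \<longleftrightarrow> strongly_measurable_on X n M f \<and> x \<in> X \<and>
     (\<exists>s :: nat \<Rightarrow> 'a \<Rightarrow> 'v.
        (\<forall>i. Bochner_Integration.simple_bochner_integrable M (s i) \<and> s i \<in> space M \<rightarrow> X) \<and>
        (\<lambda>i. \<integral>\<^sup>+t. ennreal (n (f t - s i t)) \<partial>M) \<longlonglongrightarrow> 0 \<and>
        (\<lambda>i. n (Bochner_Integration.simple_bochner_integral M (s i) - x)) \<longlonglongrightarrow> 0)"


section \<open>Weights and weighted spaces\<close>

text \<open>Powers of extended nonnegative reals, intended for positive exponents only.\<close>

definition epowr :: "ennreal \<Rightarrow> real \<Rightarrow> ennreal" where
  "epowr x a = (if x = top then top else ennreal (enn2real x powr a))"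

text \<open>
  The second average uses \<open>0 powr a = 0\<close> where the mathematical value would be infinite; this is
  harmless since weights are positive almost everywhere.
\<close>

definition Ap_const :: "real \<Rightarrow> (real \<Rightarrow> real) \<Rightarrow> ennreal" where
  "Ap_const p w = (SUP (a, b) \<in> {(a, b). a < b}.
     (ennreal (1 / (b - a)) * (\<integral>\<^sup>+t\<in>{a..b}. ennreal (w t) \<partial>lebesgue)) *
     epowr (ennreal (1 / (b - a)) * (\<integral>\<^sup>+t\<in>{a..b}. ennreal (w t powr (- 1 / (p - 1))) \<partial>lebesgue))
       (p - 1))"

definition Ap :: "real \<Rightarrow> (real \<Rightarrow> real) set" where
  "Ap p = {w. w \<in> borel_measurable lebesgue \<and> (\<forall>t. 0 \<le> w t) \<and> (AE t in lebesgue. 0 < w t) \<and>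
     Ap_const p w < top}"

definition primitive :: "(real \<Rightarrow> real) \<Rightarrow> real \<Rightarrow> real" where
  "primitive w t = (LINT s:{0..t}|lebesgue. w s)"

definition Lp_norm :: "real \<Rightarrow> real \<Rightarrow> (real \<Rightarrow> real) \<Rightarrow> ('v \<Rightarrow> real) \<Rightarrow> (real \<Rightarrow> 'v) \<Rightarrow> ennreal" where
  "Lp_norm p T w n f =
     epowr (\<integral>\<^sup>+t. ennreal (n (f t) powr p * w t) \<partial>lebesgue_on {0<..<T}) (1 / p)"

definition Lp_space ::
  "real \<Rightarrow> real \<Rightarrow> (real \<Rightarrow> real) \<Rightarrow> 'v::real_vector set \<Rightarrow> ('v \<Rightarrow> real) \<Rightarrow> (real \<Rightarrow> 'v) set" where
  "Lp_space p T w X n =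
     {f. strongly_measurable_on X n (lebesgue_on {0<..<T}) f \<and> Lp_norm p T w n f < top}"


section \<open>Function parameters\<close>

text \<open>Functions on \<open>(0,\<infinity>)\<close> are total functions on the reals of which only the values at positive
  arguments matter.\<close>

definition s_fun :: "(real \<Rightarrow> real) \<Rightarrow> real \<Rightarrow> ennreal" where
  "s_fun \<phi> r = (SUP t\<in>{0<..}. ennreal (\<phi> (r * t) / \<phi> t))"

text \<open>The two \<open>eventually\<close> clauses are the definition of little-o, for an extended-real-valued
  function on the left.\<close>

definition I_o :: "real \<Rightarrow> real \<Rightarrow> (real \<Rightarrow> real) set" where
  "I_o a b = {\<phi>. (\<forall>t>0. 0 < \<phi> t) \<and>
     (\<forall>c>0. \<forall>\<^sub>F r in at_right 0. s_fun \<phi> r \<le> ennreal (c * r powr a)) \<and>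
     (\<forall>c>0. \<forall>\<^sub>F r in at_top. s_fun \<phi> r \<le> ennreal (c * r powr b))}"

definition gen_inverse :: "(real \<Rightarrow> real) \<Rightarrow> real \<Rightarrow> real" where
  "gen_inverse \<kappa> r = Inf {s. 0 < s \<and> \<kappa> s \<le> r}"

definition kstar :: "(real \<Rightarrow> real) \<Rightarrow> real \<Rightarrow> real" where
  "kstar \<kappa> t = gen_inverse \<kappa> (1 / t)"


section \<open>Real interpolation with a function parameter\<close>

definition K_fun ::
  "real \<Rightarrow> 'v::real_vector \<Rightarrow> 'v set \<Rightarrow> ('v \<Rightarrow> real) \<Rightarrow> 'v set \<Rightarrow> ('v \<Rightarrow> real) \<Rightarrow> real" where
  "K_fun t a X0 n0 X1 n1 =
     Inf {n0 a0 + t * n1 a1 | a0 a1. a0 \<in> X0 \<and> a1 \<in> X1 \<and> a = a0 + a1}"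

definition interp_norm ::
  "(real \<Rightarrow> real) \<Rightarrow> real \<Rightarrow> 'v::real_vector set \<Rightarrow> ('v \<Rightarrow> real) \<Rightarrow> 'v set \<Rightarrow> ('v \<Rightarrow> real) \<Rightarrow> 'v \<Rightarrow> ennreal"
  where
  "interp_norm \<phi> p X0 n0 X1 n1 a =
     epowr (\<integral>\<^sup>+t\<in>{0<..}. ennreal ((\<phi> (1 / t) * K_fun t a X0 n0 X1 n1) powr p / t) \<partial>lebesgue) (1 / p)"

definition interp_space ::
  "(real \<Rightarrow> real) \<Rightarrow> real \<Rightarrow> 'v::real_vector set \<Rightarrow> ('v \<Rightarrow> real) \<Rightarrow> 'v set \<Rightarrow> ('v \<Rightarrow> real) \<Rightarrow> 'v set" where
  "interp_space \<phi> p X0 n0 X1 n1 =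
     {a. (\<exists>a0\<in>X0. \<exists>a1\<in>X1. a = a0 + a1) \<and> interp_norm \<phi> p X0 n0 X1 n1 a < top}"


section \<open>The constant in the trace estimate\<close>

text \<open>
  The constant \<open>N\<close> of the trace estimate may depend on \<open>p\<close>, the \<open>A\<^sub>p\<close>-constant of \<open>w\<close>, \<open>\<kappa>\<close>, the
  embedding constant, \<open>T\<close>, and in addition on the function \<open>\<sigma> = s_fun (W \<circ> kstar \<kappa>)\<close>, i.e. on how the
  hypothesis \<open>W \<circ> kstar \<kappa> \<in> I_o 0 p\<close> is realized.  Without \<open>\<sigma>\<close> the estimate is false.  Take both
  spaces equal to the real line, \<open>T = 1\<close>, \<open>p = 2\<close>, \<open>\<kappa> t = t powr (-1/2)\<close>, \<open>u = u0 = 1\<close>, \<open>f = 0\<close> and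
  \<open>w t = \<bar>t\<bar> powr (\<gamma> - 1)\<close> with \<open>\<gamma> < 1\<close>.  As \<open>\<gamma>\<close> tends to \<open>1\<close>, the \<open>A\<^sub>2\<close>-constants and the norm of
  \<open>u\<close> tend to \<open>1\<close>, but the square of the interpolation norm of \<open>u0\<close> is at least
  \<open>1 / (\<gamma> * (2 - 2 * \<gamma>))\<close>.  Multiplying \<open>w\<close> by a suitable constant on the negative half-line makes all
  the \<open>A\<^sub>2\<close>-constants equal without affecting anything else.
\<close>

end

theory Submission
  imports Defs
begin

text \<open>
  Write \<open>W\<close> for the primitive of the weight, \<open>k x\<close> for the integral of \<open>\<kappa>\<close> over \<open>(0, x)\<close> and \<open>K \<tau>\<close> for the
  K-functional of \<open>u0\<close>.  Since \<open>kstar \<kappa> (1 / \<tau>) = \<kappa>\<^sup>-\<^sup>1 \<tau>\<close>, the \<open>p\<close>-th power of the interpolation norm is the integral of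
  \<open>W (\<kappa>\<^sup>-\<^sup>1 \<tau>) * K \<tau> powr p\<close> against \<open>d\<tau> / \<tau>\<close>, so \<open>K \<tau>\<close> has to be estimated at the time \<open>t = \<kappa>\<^sup>-\<^sup>1 \<tau>\<close>.

  The equation expresses \<open>k x *\<^sub>R u0\<close> as the integral of \<open>\<kappa> (x - s) *\<^sub>R u s\<close> minus the integral of \<open>f\<close>
  over \<open>(0, x)\<close>.  The first part is measured in the smaller space, the second in the larger one
  (\<open>convolution_K_bound\<close>).  Averaging over \<open>x\<close> in \<open>(t / 2, t)\<close> smooths the singular kernel away, and since
  \<open>\<tau> * t \<le> k t\<close> and \<open>k t \<le> 2 * k (t / 2)\<close> nothing is left of the kernel: \<open>K \<tau>\<close> is at most four times
  the average over \<open>(0, t)\<close> of \<open>h s = n0 (u s) + n1 (f s)\<close> (\<open>average_convolution_bound\<close>).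

  It remains to bound these averages in a weighted space.  The little-o conditions yield power bounds
  (\<open>power_growth\<close>), in particular \<open>W t \<le> C * (t / r) powr d * W r\<close> for \<open>r \<le> t\<close> with some \<open>d < p\<close>
  (\<open>primitive_growth\<close>).  Together with the Muckenhoupt condition this gives a Hardy inequality that bounds
  \<open>W t\<close> times the \<open>p\<close>-th power of the average by the integral of \<open>(s / t) powr a * h s powr p * w s\<close> over
  \<open>(0, t)\<close> with some \<open>a > 0\<close> (\<open>weighted_Hardy\<close>).  The factor
  \<open>(s / t) powr a\<close> makes the integral in \<open>d\<tau> / \<tau>\<close> converge uniformly in \<open>s\<close>, which settles all \<open>\<tau>\<close> with
  \<open>\<kappa>\<^sup>-\<^sup>1 \<tau> \<le> T\<close>.  For the remaining small \<open>\<tau>\<close> the embedding of \<open>X0\<close> into \<open>X1\<close> reduces \<open>K \<tau>\<close> to its value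
  at \<open>\<kappa> T\<close> (\<open>weighted_interpolation_integral\<close>).

  The constant depends on the weight only through its Muckenhoupt constant and through a dilation
  factor \<open>\<Lambda>\<close> at which \<open>s_fun (W \<circ> kstar \<kappa>) \<Lambda> \<le> \<Lambda> powr p / 2\<close>; such a \<open>\<Lambda>\<close> is determined by the function
  \<open>\<sigma>\<close>.
\<close>

section \<open>Power bounds from the little-o conditions\<close>

text \<open>
  Iterating one step \<open>x \<mapsto> L * x\<close> and filling the gaps by monotonicity turns a single strict gain at one
  dilation factor into a power bound at all scales.  The exponent drops by \<open>log L 2\<close> because the
  factor \<open>1 / 2\<close> is collected once per step.  Monotonicity of \<open>F\<close> forces the new exponent to stay
  nonnegative.  It is applied to \<open>x \<mapsto> \<kappa> (1 / x)\<close> with \<open>p = 1\<close> and to \<open>W \<circ> kstar \<kappa>\<close>, where the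
  little-o conditions provide the dilation factor.
\<close>

lemma power_growth:
  fixes F :: "real \<Rightarrow> real"
  assumes mono: "\<And>x y. 0 < x \<Longrightarrow> x \<le> y \<Longrightarrow> F x \<le> F y"
    and pos: "\<And>x. 0 < x \<Longrightarrow> 0 < F x"
    and L: "1 < L"
    and step: "\<And>x. 0 < x \<Longrightarrow> F (L * x) \<le> L powr p / 2 * F x"
    and d_def: "d = p - log L 2"
  shows "0 \<le> d" and "0 < x \<Longrightarrow> x \<le> y \<Longrightarrow> F y \<le> L powr d * (y / x) powr d * F x"
proof -
  have Ld: "L powr d = L powr p / 2"
    using L by (simp add: d_def powr_diff)
  have "F 1 \<le> F L" using mono[of 1 L] L by simp
  also have "\<dots> \<le> L powr d * F 1" using step[of 1] unfolding Ld by simp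
  finally have "F 1 \<le> L powr d * F 1" .
  then have "1 \<le> L powr d"
    using pos[of 1] by simp
  then show d0: "0 \<le> d"
    using powr_less_mono[of d 0 L] L by force
  have iter: "F (L ^ n * x) \<le> (L powr d) ^ n * F x" if "0 < x" for n :: nat and x
  proof (induction n)
    case (Suc n)
    have "F (L ^ Suc n * x) \<le> L powr d * F (L ^ n * x)"
      using step[of "L ^ n * x"] that L unfolding Ld by (simp add: mult.assoc)
    also have "\<dots> \<le> L powr d * ((L powr d) ^ n * F x)"
      by (intro mult_left_mono Suc) simp
    finally show ?case by (simp add: mult.assoc)
  qed simp
  assume xy: "0 < x" "x \<le> y"
  define n where "n = nat \<lfloor>log L (y / x)\<rfloor>"
  have yx: "1 \<le> y / x" using xy by simp
  then have lg: "0 \<le> log L (y / x)" using L by simp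
  then have n: "real n \<le> log L (y / x)" "log L (y / x) \<le> real (Suc n)"
    unfolding n_def by linarith+
  have "y / x = L powr log L (y / x)" using L xy by simp
  also have "\<dots> \<le> L powr real (Suc n)" by (rule powr_mono) (use n L in auto)
  also have "\<dots> = L ^ Suc n" using L by (subst powr_realpow) auto
  finally have "y \<le> L ^ Suc n * x" using xy by (simp add: field_simps)
  then have "F y \<le> F (L ^ Suc n * x)" using mono[of y] xy by auto
  also have "\<dots> \<le> (L powr d) ^ Suc n * F x" by (rule iter) fact
  also have "(L powr d) ^ Suc n = L powr d * (L powr real n) powr d"
    using L by (simp add: powr_powr mult.commute flip: powr_realpow)
  also have "\<dots> \<le> L powr d * (y / x) powr d"
  proof (intro mult_left_mono powr_mono2 d0)
    have "L powr real n \<le> L powr log L (y / x)" by (rule powr_mono) (use n L in auto)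
    then show "L powr real n \<le> y / x" using L xy by simp
  qed auto
  finally show "F y \<le> L powr d * (y / x) powr d * F x"
    using pos[OF xy(1)] by (simp add: mult_right_mono)
qed

lemma s_fun_le_iff:
  assumes "\<And>t. 0 < t \<Longrightarrow> 0 < \<phi> t" "0 \<le> c"
  shows "s_fun \<phi> r \<le> ennreal c \<longleftrightarrow> (\<forall>t>0. \<phi> (r * t) \<le> c * \<phi> t)"
  using assms by (auto simp: s_fun_def SUP_le_iff ennreal_le_iff field_simps)

lemma I_o_pos: "\<phi> \<in> I_o a b \<Longrightarrow> 0 < t \<Longrightarrow> 0 < \<phi> t"
  by (simp add: I_o_def)

lemma I_o_small_at_top:
  assumes "\<phi> \<in> I_o a b" "0 < c"
  shows "\<exists>r>1. s_fun \<phi> r \<le> ennreal (c * r powr b)"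
proof -
  have "\<forall>\<^sub>F r in at_top. s_fun \<phi> r \<le> ennreal (c * r powr b)"
    using assms unfolding I_o_def mem_Collect_eq by blast
  then have "\<forall>\<^sub>F r in at_top. s_fun \<phi> r \<le> ennreal (c * r powr b) \<and> 1 < r"
    using eventually_gt_at_top by (rule eventually_conj)
  then show ?thesis
    using eventually_happens'[OF trivial_limit_at_top_linorder] by blast
qed

lemma I_o_small_at_0:
  assumes "\<phi> \<in> I_o a b" "0 < c"
  shows "\<exists>r>0. r < 1 \<and> s_fun \<phi> r \<le> ennreal (c * r powr a)"
proof -
  have "\<forall>\<^sub>F r in at_right 0. s_fun \<phi> r \<le> ennreal (c * r powr a)"
    using assms unfolding I_o_def mem_Collect_eq by blast
  moreover have "\<forall>\<^sub>F r in at_right 0. r \<in> {0<..<1::real}"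
    by (rule eventually_at_right_real) simp
  ultimately have "\<forall>\<^sub>F r in at_right 0. s_fun \<phi> r \<le> ennreal (c * r powr a) \<and> r \<in> {0<..<1::real}"
    by (rule eventually_conj)
  then show ?thesis
    using eventually_happens'[OF trivial_limit_at_right_real] by fastforce
qed

section \<open>Integration on the real line\<close>

lemma nn_integral_closed_open_interval:
  fixes f :: "real \<Rightarrow> ennreal"
  shows "(\<integral>\<^sup>+x. f x * indicator {a..b} x \<partial>lborel) = (\<integral>\<^sup>+x. f x * indicator {a<..<b} x \<partial>lborel)"
proof (rule nn_integral_cong_AE)
  show "AE x in lborel. f x * indicator {a..b} x = f x * indicator {a<..<b} x"
    using AE_lborel_singleton[of a] AE_lborel_singleton[of b]
    by eventually_elim (auto split: split_indicator)
qed

lemma nn_integral_powr_0: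
  assumes "0 < b" "0 \<le> c"
  shows "(\<integral>\<^sup>+x. ennreal (x powr (b - 1)) * indicator {0<..<c} x \<partial>lborel) = ennreal (c powr b / b)"
proof -
  have "((\<lambda>x. x powr (b - 1)) has_integral (c powr b / b)) {0..c}"
    using has_integral_powr_from_0[of "b - 1" c] assms by simp
  then have "(\<integral>\<^sup>+x. ennreal (x powr (b - 1)) * indicator {0..c} x \<partial>lborel) = ennreal (c powr b / b)"
    by (intro nn_integral_has_integral_lebesgue') auto
  then show ?thesis by (simp add: nn_integral_closed_open_interval)
qed

lemma nn_integral_powr_neg:
  fixes s t \<alpha> :: real
  assumes "0 < s" "s \<le> t" "0 < \<alpha>"
  shows "(\<integral>\<^sup>+r. ennreal (\<alpha> * r powr (- \<alpha> - 1)) * indicator {s<..<t} r \<partial>lborel) = ennreal (s powr - \<alpha> - t powr - \<alpha>)"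
proof -
  have "((\<lambda>r. \<alpha> * r powr (- \<alpha> - 1)) has_integral (- (t powr - \<alpha>) - - (s powr - \<alpha>))) {s..t}"
  proof (rule fundamental_theorem_of_calculus[OF assms(2)])
    fix x assume x: "x \<in> {s..t}"
    have "((\<lambda>r. - (r powr - \<alpha>)) has_real_derivative \<alpha> * x powr (- \<alpha> - 1)) (at x within {s..t})"
      using x assms by (auto intro!: derivative_eq_intros simp: divide_simps)
    then show "((\<lambda>r. - (r powr - \<alpha>)) has_vector_derivative \<alpha> * x powr (- \<alpha> - 1)) (at x within {s..t})"
      by (rule has_real_derivative_iff_has_vector_derivative[THEN iffD1])
  qed
  then have "(\<integral>\<^sup>+r. ennreal (\<alpha> * r powr (- \<alpha> - 1)) * indicator {s..t} r \<partial>lborel) = ennreal (- (t powr - \<alpha>) - - (s powr - \<alpha>))"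
    using assms by (intro nn_integral_has_integral_lebesgue') auto
  then show ?thesis by (simp add: nn_integral_closed_open_interval)
qed

text \<open>
  The weight and the data are only Lebesgue measurable, whereas the product of the completed measures
  is not complete.  Replacing \<open>g\<close> by a Borel function that agrees with it almost everywhere reduces
  the exchange of integrals to the Borel case.
\<close>

lemma lebesgue_Tonelli:
  fixes g :: "real \<Rightarrow> ennreal" and k :: "real \<Rightarrow> real \<Rightarrow> ennreal"
  assumes g: "g \<in> borel_measurable lebesgue"
    and k[measurable]: "(\<lambda>(x, s). k x s) \<in> borel_measurable (borel \<Otimes>\<^sub>M borel)"
  shows "(\<lambda>x. \<integral>\<^sup>+s. k x s * g s \<partial>lebesgue) \<in> borel_measurable borel"
    and "(\<integral>\<^sup>+x. (\<integral>\<^sup>+s. k x s * g s \<partial>lebesgue) \<partial>lborel) = (\<integral>\<^sup>+s. (\<integral>\<^sup>+x. k x s \<partial>lborel) * g s \<partial>lebesgue)"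
proof -
  obtain g' where g'[measurable]: "g' \<in> borel_measurable lborel" and eq: "AE s in lborel. g s = g' s"
    using completion_ex_borel_measurable[OF g] by auto
  have inner: "(\<integral>\<^sup>+s. k x s * g s \<partial>lebesgue) = (\<integral>\<^sup>+s. k x s * g' s \<partial>lborel)" for x
    unfolding nn_integral_completion
    by (rule nn_integral_cong_AE) (use eq in \<open>auto elim: eventually_mono\<close>)
  show "(\<lambda>x. \<integral>\<^sup>+s. k x s * g s \<partial>lebesgue) \<in> borel_measurable borel"
    unfolding inner by measurable
  have "(\<integral>\<^sup>+x. (\<integral>\<^sup>+s. k x s * g s \<partial>lebesgue) \<partial>lborel) = (\<integral>\<^sup>+x. (\<integral>\<^sup>+s. k x s * g' s \<partial>lborel) \<partial>lborel)"
    by (simp add: inner)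
  also have "\<dots> = (\<integral>\<^sup>+s. (\<integral>\<^sup>+x. k x s * g' s \<partial>lborel) \<partial>lborel)"
    by (rule lborel_pair.Fubini') simp
  also have "\<dots> = (\<integral>\<^sup>+s. (\<integral>\<^sup>+x. k x s \<partial>lborel) * g' s \<partial>lborel)"
    by (subst nn_integral_multc) auto
  also have "\<dots> = (\<integral>\<^sup>+s. (\<integral>\<^sup>+x. k x s \<partial>lborel) * g s \<partial>lebesgue)"
    unfolding nn_integral_completion
    by (rule nn_integral_cong_AE) (use eq in \<open>auto elim: eventually_mono\<close>)
  finally show "(\<integral>\<^sup>+x. (\<integral>\<^sup>+s. k x s * g s \<partial>lebesgue) \<partial>lborel)
      = (\<integral>\<^sup>+s. (\<integral>\<^sup>+x. k x s \<partial>lborel) * g s \<partial>lebesgue)" .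
qed

text \<open>
  The inequality of Hoelder, solved for the norm of \<open>f\<close>.  This form stays meaningful when that norm is
  infinite, and replacing it by any strictly larger real number \<open>a\<close> avoids a division by zero when it
  vanishes; the claim then follows by letting \<open>a\<close> decrease to it.
\<close>

lemma Holder_lower_bound:
  fixes f g :: "'a \<Rightarrow> real"
  assumes f[measurable]: "f \<in> borel_measurable M" and g[measurable]: "g \<in> borel_measurable M"
    and nn: "\<And>x. 0 \<le> f x" "\<And>x. 0 \<le> g x"
    and p: "1 < p" "q = p / (p - 1)" and b: "0 < b" and k: "0 \<le> k"
    and kle: "ennreal k \<le> (\<integral>\<^sup>+x. f x * g x \<partial>M)"
    and gle: "(\<integral>\<^sup>+x. g x powr q \<partial>M) \<le> ennreal b"
  shows "ennreal (k powr p / b powr (p - 1)) \<le> (\<integral>\<^sup>+x. f x powr p \<partial>M)"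
proof (cases "(\<integral>\<^sup>+x. f x powr p \<partial>M)")
  case (real X)
  have q: "1 < q" using p(1) unfolding p(2) by (simp add: field_simps)
  have pq: "1 / p + 1 / q = 1" using p(1) unfolding p(2) by (simp add: field_simps)
  have "k powr p / b powr (p - 1) \<le> a" if a: "X < a" for a
  proof -
    have a0: "0 < a" using real a by simp
    define u v where "u = a powr (1 / p)" and "v = b powr (1 / q)"
    have uv: "0 < u" "0 < v" using a0 b by (auto simp: u_def v_def)
    have pw: "u powr p = a" "v powr q = b" using a0 b p q by (auto simp: u_def v_def powr_powr)
    have young: "f x * g x \<le> u * v * (f x powr p / (p * a) + g x powr q / (q * b))" for x
    proof -
      have "f x / u * (g x / v) \<le> (f x / u) powr p / p + (g x / v) powr q / q"
        by (rule Youngs_inequality) (use p(1) q pq nn uv in auto)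
      also have "\<dots> = f x powr p / (p * a) + g x powr q / (q * b)"
        using uv nn pw by (simp add: powr_divide mult.commute)
      finally show ?thesis using uv by (simp add: field_simps)
    qed
    have "ennreal k \<le> (\<integral>\<^sup>+x. f x * g x \<partial>M)" by fact
    also have "\<dots> \<le> (\<integral>\<^sup>+x. ennreal (u * v / (p * a)) * ennreal (f x powr p)
                          + ennreal (u * v / (q * b)) * ennreal (g x powr q) \<partial>M)"
    proof (rule nn_integral_mono)
      fix x
      have "ennreal (u * v / (p * a)) * ennreal (f x powr p)
                          + ennreal (u * v / (q * b)) * ennreal (g x powr q)
         = ennreal (u * v / (p * a) * f x powr p + u * v / (q * b) * g x powr q)"
        using uv p(1) q a0 b
        by (subst ennreal_plus) (auto simp flip: ennreal_mult)
      with young[of x] show "ennreal (f x * g x) \<le> ennreal (u * v / (p * a)) * ennreal (f x powr p)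
                          + ennreal (u * v / (q * b)) * ennreal (g x powr q)"
        by (simp add: algebra_simps ennreal_leI)
    qed
    also have "\<dots> = ennreal (u * v / (p * a)) * (\<integral>\<^sup>+x. f x powr p \<partial>M)
        + ennreal (u * v / (q * b)) * (\<integral>\<^sup>+x. g x powr q \<partial>M)"
      by (subst nn_integral_add) (auto simp: nn_integral_cmult)
    also have "\<dots> \<le> ennreal (u * v / (p * a)) * ennreal a + ennreal (u * v / (q * b)) * ennreal b"
      using real a by (intro add_mono mult_left_mono gle) (auto simp: ennreal_leI)
    also have "\<dots> = ennreal (u * v / p + u * v / q)"
      using uv p q a0 b by (simp flip: ennreal_mult ennreal_plus)
    also have "u * v / p + u * v / q = u * v * (1 / p + 1 / q)" by (simp add: field_simps)
    also have "\<dots> = u * v" using pq by simp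
    finally have "k \<le> u * v" using uv by simp
    then have "k powr p \<le> (u * v) powr p" using k p by (intro powr_mono2) auto
    also have "\<dots> = a * b powr (p / q)"
      using uv pw p b by (simp add: powr_mult v_def powr_powr)
    also have "p / q = p - 1" using p(1) unfolding p(2) by simp
    finally show ?thesis using b by (simp add: field_simps)
  qed
  then have "k powr p / b powr (p - 1) \<le> X" by (rule dense_ge)
  then show ?thesis using real by (simp add: ennreal_leI)
qed simp

section \<open>The kernel and its generalized inverse\<close>

locale convolution_kernel =
  fixes \<kappa> :: "real \<Rightarrow> real"
  assumes right_cont: "\<forall>t>0. continuous (at_right t) \<kappa>"
    and decreasing: "antimono_on {0<..} \<kappa>"
    and index: "\<kappa> \<in> I_o (- 1) 0"
begin

lemma kappa_pos: "0 < s \<Longrightarrow> 0 < \<kappa> s"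
  using index by (rule I_o_pos)

lemma kappa_antimono: "0 < s \<Longrightarrow> s \<le> t \<Longrightarrow> \<kappa> t \<le> \<kappa> s"
  using decreasing by (auto simp: monotone_on_def)

text \<open>
  The strict inequality \<open>e < 1\<close> is what makes \<open>\<kappa>\<close> integrable at the origin.
\<close>

lemma kappa_growth:
  obtains M e where "1 \<le> M" "0 \<le> e" "e < 1"
    "\<And>r t. 0 < r \<Longrightarrow> r \<le> t \<Longrightarrow> \<kappa> r \<le> M * (t / r) powr e * \<kappa> t"
proof -
  obtain r where r: "0 < r" "r < 1" "s_fun \<kappa> r \<le> ennreal (1 / 2 * r powr - 1)"
    using I_o_small_at_0[OF index, of "1 / 2"] by auto
  have step: "\<kappa> (r * t) \<le> 1 / (2 * r) * \<kappa> t" if "0 < t" for t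
  proof -
    have "\<kappa> (r * t) \<le> 1 / 2 * r powr - 1 * \<kappa> t"
      using r(3) that s_fun_le_iff[of \<kappa> "1 / 2 * r powr - 1" r] kappa_pos by simp
    also have "1 / 2 * r powr - 1 = 1 / (2 * r)" using r by (simp add: powr_minus_divide)
    finally show ?thesis .
  qed
  define F where "F x = \<kappa> (1 / x)" for x
  have 1: "F x \<le> F y" if "0 < x" "x \<le> y" for x y
    unfolding F_def by (rule kappa_antimono) (use that in \<open>auto simp: field_simps\<close>)
  have 2: "0 < F x" if "0 < x" for x
    unfolding F_def by (rule kappa_pos) (use that in auto)
  have 3: "1 < 1 / r" using r by simp
  have 4: "F (1 / r * x) \<le> (1 / r) powr 1 / 2 * F x" if "0 < x" for x
    using step[of "1 / x"] that r by (simp add: F_def)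
  define e where "e = 1 - log (1 / r) 2"
  note g = power_growth[of F "1 / r" 1 e, OF 1 2 3 4 e_def]
  have "0 \<le> e" by (rule g(1))
  have "e < 1" using 3 by (simp add: e_def)
  have growth: "\<kappa> s \<le> (1 / r) powr e * (t / s) powr e * \<kappa> t" if "0 < s" "s \<le> t" for s t
  proof -
    have "F (1 / s) \<le> (1 / r) powr e * ((1 / s) / (1 / t)) powr e * F (1 / t)"
      by (rule g(2)) (use that in \<open>auto simp: frac_le\<close>)
    also have "(1 / s) / (1 / t) = t / s" by simp
    finally show ?thesis by (simp add: F_def)
  qed
  show thesis
    by (rule that[OF _ \<open>0 \<le> e\<close> \<open>e < 1\<close> growth]) (use 3 \<open>0 \<le> e\<close> in \<open>auto intro: ge_one_powr_ge_zero\<close>)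
qed

lemma kappa_le_somewhere:
  assumes "0 < \<tau>" shows "\<exists>s>0. \<kappa> s \<le> \<tau>"
proof -
  have k1: "0 < \<kappa> 1" by (rule kappa_pos) simp
  define c where "c = \<tau> / \<kappa> 1"
  have c: "0 < c" using assms k1 by (simp add: c_def)
  then obtain r where r: "1 < r" "s_fun \<kappa> r \<le> ennreal c"
    using I_o_small_at_top[OF index, of c] by auto
  then have "\<kappa> (r * 1) \<le> c * \<kappa> 1"
    using s_fun_le_iff[of \<kappa> c r] kappa_pos c by (simp del: mult_1_right)
  then show ?thesis using r k1 by (intro exI[of _ r]) (auto simp: c_def)
qed

lemma kappa_unbounded:
  assumes "0 < \<tau>" shows "\<exists>s>0. \<tau> < \<kappa> s"
proof -
  have k1: "0 < \<kappa> 1" by (rule kappa_pos) simp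
  define c where "c = \<kappa> 1 / (2 * \<tau>)"
  have c: "0 < c" using assms k1 by (simp add: c_def)
  then obtain r where r: "1 < r" "s_fun \<kappa> r \<le> ennreal c"
    using I_o_small_at_top[OF index, of c] by auto
  then have "\<kappa> (r * (1 / r)) \<le> c * \<kappa> (1 / r)"
    using s_fun_le_iff[of \<kappa> c r] kappa_pos c by (simp del: times_divide_eq_right)
  then have "2 * \<tau> \<le> \<kappa> (1 / r)" using r k1 assms by (simp add: c_def field_simps)
  then show ?thesis using r assms by (intro exI[of _ "1 / r"]) auto
qed

text \<open>
  The Galois connection between \<open>\<kappa>\<close> and its generalized inverse.  Right-continuity makes the infimum
  attained; this gives the direction from left to right.
\<close>

lemma gen_inverse_le_iff:
  assumes "0 < \<tau>" "0 < s"
  shows "gen_inverse \<kappa> \<tau> \<le> s \<longleftrightarrow> \<kappa> s \<le> \<tau>"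
proof
  assume "\<kappa> s \<le> \<tau>"
  then show "gen_inverse \<kappa> \<tau> \<le> s"
    unfolding gen_inverse_def using assms by (intro cInf_lower bdd_belowI[of _ 0]) auto
next
  assume le: "gen_inverse \<kappa> \<tau> \<le> s"
  show "\<kappa> s \<le> \<tau>"
  proof (rule ccontr)
    assume "\<not> \<kappa> s \<le> \<tau>"
    then have gt: "\<tau> < \<kappa> s" by simp
    have "(\<kappa> \<longlongrightarrow> \<kappa> s) (at_right s)"
      using right_cont assms by (simp add: continuous_within)
    then have "\<forall>\<^sub>F x in at_right s. \<tau> < \<kappa> x" using gt by (rule order_tendstoD)
    then obtain b where b: "s < b" "\<And>x. s < x \<Longrightarrow> x < b \<Longrightarrow> \<tau> < \<kappa> x"
      by (auto simp: eventually_at_right_field)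
    define c where "c = (s + b) / 2"
    have c: "s < c" "c < b" using b by (auto simp: c_def)
    have "c \<le> gen_inverse \<kappa> \<tau>"
      unfolding gen_inverse_def
    proof (rule cInf_greatest)
      show "{s. 0 < s \<and> \<kappa> s \<le> \<tau>} \<noteq> {}" using kappa_le_somewhere[OF assms(1)] by auto
      fix x assume x: "x \<in> {s. 0 < s \<and> \<kappa> s \<le> \<tau>}"
      show "c \<le> x"
      proof (rule ccontr)
        assume "\<not> c \<le> x"
        then have "\<kappa> c \<le> \<kappa> x" using x by (intro kappa_antimono) auto
        then show False using b(2)[OF c] x by auto
      qed
    qed
    then show False using c le by simp
  qed
qed

lemma gen_inverse_pos:
  assumes "0 < \<tau>" shows "0 < gen_inverse \<kappa> \<tau>"
proof -
  obtain s where s: "0 < s" "\<tau> < \<kappa> s" using kappa_unbounded[OF assms] by auto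
  then show ?thesis using gen_inverse_le_iff[OF assms s(1)] by auto
qed

definition kint :: "real \<Rightarrow> ennreal" where
  "kint t = (\<integral>\<^sup>+s. ennreal (\<kappa> s) * indicator {0<..<t} s \<partial>lborel)"

lemma kappa_measurable:
  "(\<lambda>s. indicator {0<..} s * \<kappa> s) \<in> borel_measurable borel"
proof -
  have "(\<lambda>s. - \<kappa> s) \<in> borel_measurable (restrict_space borel {0<..})"
    by (rule borel_measurable_mono_on_fnc) (auto simp: mono_on_def intro: kappa_antimono)
  then have "(\<lambda>s. - (- \<kappa> s)) \<in> borel_measurable (restrict_space borel {0<..})"
    by (rule borel_measurable_uminus)
  then show ?thesis
    by (simp add: borel_measurable_restrict_space_iff)
qed

lemma kappa_ennreal_measurable[measurable]:
  "(\<lambda>s. ennreal (\<kappa> s) * indicator {0<..<t} s) \<in> borel_measurable borel"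
proof -
  have "(\<lambda>s. ennreal (indicator {0<..} s * \<kappa> s) * indicator {0<..<t} s) \<in> borel_measurable borel"
    using kappa_measurable by measurable
  also have "(\<lambda>s. ennreal (indicator {0<..} s * \<kappa> s) * indicator {0<..<t} s) =
     (\<lambda>s. ennreal (\<kappa> s) * indicator {0<..<t} s)"
    by (auto simp: fun_eq_iff split: split_indicator)
  finally show ?thesis .
qed

lemma kint_finite: "kint t < top"
proof (cases "0 < t")
  case True
  obtain M e where Me: "1 \<le> M" "0 \<le> e" "e < 1"
    and g: "\<And>r t. 0 < r \<Longrightarrow> r \<le> t \<Longrightarrow> \<kappa> r \<le> M * (t / r) powr e * \<kappa> t"
    using kappa_growth by blast
  have "kint t \<le> (\<integral>\<^sup>+s. ennreal (M * t powr e * \<kappa> t) * (ennreal (s powr (1 - e - 1)) * indicator {0<..<t} s) \<partial>lborel)"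
    unfolding kint_def
  proof (rule nn_integral_mono)
    fix s
    have "\<kappa> s \<le> M * t powr e * \<kappa> t * s powr (1 - e - 1)" if "0 < s" "s < t"
    proof -
      have "(t / s) powr e = t powr e * s powr (1 - e - 1)"
        using that by (simp add: powr_divide powr_minus_divide)
      then show ?thesis using g[of s t] that by (simp add: mult.commute mult.left_commute)
    qed
    then show "ennreal (\<kappa> s) * indicator {0<..<t} s \<le> ennreal (M * t powr e * \<kappa> t) * (ennreal (s powr (1 - e - 1)) * indicator {0<..<t} s)"
      using Me kappa_pos[of t] True
      by (auto split: split_indicator simp del: diff_add_cancel simp flip: ennreal_mult intro!: ennreal_leI)
  qed
  also have "\<dots> = ennreal (M * t powr e * \<kappa> t) * ennreal (t powr (1 - e) / (1 - e))"
  proof -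
    have "(\<integral>\<^sup>+s. ennreal (s powr (1 - e - 1)) * indicator {0<..<t} s \<partial>lborel) = ennreal (t powr (1 - e) / (1 - e))"
      by (rule nn_integral_powr_0) (use Me True in auto)
    then show ?thesis by (subst nn_integral_cmult) auto
  qed
  also have "\<dots> < top" by (simp add: ennreal_mult_less_top)
  finally show ?thesis .
next
  case False
  then show ?thesis by (simp add: kint_def)
qed

lemma kint_mono: "s \<le> t \<Longrightarrow> kint s \<le> kint t"
  unfolding kint_def by (intro nn_integral_mono) (auto split: split_indicator)

lemma kint_ge:
  assumes "0 < t" shows "ennreal (t * \<kappa> t) \<le> kint t"
proof -
  have "ennreal (t * \<kappa> t) = (\<integral>\<^sup>+s. ennreal (\<kappa> t) * indicator {0<..<t} s \<partial>lborel)"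
    using assms kappa_pos[of t] by (simp add: nn_integral_cmult_indicator ennreal_mult mult.commute)
  also have "\<dots> \<le> kint t"
    unfolding kint_def
    by (intro nn_integral_mono) (auto split: split_indicator intro!: ennreal_leI kappa_antimono)
  finally show ?thesis .
qed

text \<open>
  Below \<open>gen_inverse \<kappa> \<tau>\<close> the kernel exceeds \<open>\<tau>\<close>.  Since \<open>\<kappa>\<close> may jump, \<open>\<tau>\<close> can be larger than the value
  of \<open>\<kappa>\<close> at that point, so \<open>kint_ge\<close> would not be enough.
\<close>

lemma kint_ge_inverse:
  assumes "0 < \<tau>" shows "ennreal (gen_inverse \<kappa> \<tau> * \<tau>) \<le> kint (gen_inverse \<kappa> \<tau>)"
proof -
  let ?t = "gen_inverse \<kappa> \<tau>"
  have "ennreal (?t * \<tau>) = (\<integral>\<^sup>+s. ennreal \<tau> * indicator {0<..<?t} s \<partial>lborel)"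
    using assms gen_inverse_pos[OF assms] by (simp add: nn_integral_cmult_indicator ennreal_mult mult.commute)
  also have "\<dots> \<le> kint ?t"
    unfolding kint_def
  proof (intro nn_integral_mono)
    fix s show "ennreal \<tau> * indicator {0<..<?t} s \<le> ennreal (\<kappa> s) * indicator {0<..<?t} s"
      using gen_inverse_le_iff[OF assms, of s] by (auto split: split_indicator intro!: ennreal_leI)
  qed
  finally show ?thesis .
qed

lemma kint_translate:
  "(\<integral>\<^sup>+x. ennreal (\<kappa> (x - s)) * indicator {s<..<t} x \<partial>lborel) = kint (t - s)"
proof -
  have "kint (t - s) = (\<integral>\<^sup>+x. ennreal (\<kappa> (- s + 1 * x)) * indicator {0<..<t - s} (- s + 1 * x) \<partial>lborel)"
    unfolding kint_def by (subst nn_integral_real_affine[where c = 1 and t = "- s"]) auto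
  also have "\<dots> = (\<integral>\<^sup>+x. ennreal (\<kappa> (x - s)) * indicator {s<..<t} x \<partial>lborel)"
    by (intro nn_integral_cong) (auto split: split_indicator)
  finally show ?thesis by simp
qed

lemma kint_reflect:
  "(\<integral>\<^sup>+s. ennreal (\<kappa> (t - s)) * indicator {0<..<t} s \<partial>lborel) = kint t"
proof -
  have "kint t = (\<integral>\<^sup>+s. ennreal (\<kappa> (t + (-1) * s)) * indicator {0<..<t} (t + (-1) * s) \<partial>lborel)"
    unfolding kint_def by (subst nn_integral_real_affine[where c = "-1" and t = t]) auto
  also have "\<dots> = (\<integral>\<^sup>+s. ennreal (\<kappa> (t - s)) * indicator {0<..<t} s \<partial>lborel)"
    by (intro nn_integral_cong) (auto split: split_indicator)
  finally show ?thesis by simp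
qed

lemma kint_half:
  assumes "0 < t" shows "kint t \<le> 2 * kint (t / 2)"
proof -
  have "kint t \<le> (\<integral>\<^sup>+s. ennreal (\<kappa> s) * indicator {0<..<t/2} s + ennreal (\<kappa> (s - t/2)) * indicator {t/2<..<t} s \<partial>lborel)"
    unfolding kint_def
  proof (rule nn_integral_mono_AE)
    show "AE s in lborel. ennreal (\<kappa> s) * indicator {0<..<t} s \<le>
      ennreal (\<kappa> s) * indicator {0<..<t/2} s + ennreal (\<kappa> (s - t/2)) * indicator {t/2<..<t} s"
      using AE_lborel_singleton[of "t/2"]
    proof eventually_elim
      case (elim s)
      show ?case
        using elim assms kappa_antimono[of "s - t/2" s]
        by (auto split: split_indicator intro!: ennreal_leI)
    qed
  qed
  also have "\<dots> = kint (t / 2) + kint (t / 2)"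
  proof (subst nn_integral_add)
    have "(\<lambda>s. ennreal (\<kappa> (s - t/2)) * indicator {0<..<t/2} (s - t/2)) \<in> borel_measurable borel"
      using measurable_compose[OF _ kappa_ennreal_measurable, of "\<lambda>s. s - t/2" borel] by simp
    also have "(\<lambda>s. ennreal (\<kappa> (s - t/2)) * indicator {0<..<t/2} (s - t/2)) = (\<lambda>s. ennreal (\<kappa> (s - t/2)) * indicator {t/2<..<t} s)"
      by (auto simp: fun_eq_iff split: split_indicator)
    finally show "(\<lambda>s. ennreal (\<kappa> (s - t/2)) * indicator {t/2<..<t} s) \<in> borel_measurable lborel" by simp
  qed (auto simp: kint_translate, simp_all add: kint_def)
  finally show ?thesis by (simp add: mult_2)
qed

end

section \<open>Bochner integrals and sublinear functionals\<close>

lemma (in complete_measure) borel_measurable_AE_cong: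
  assumes f: "f \<in> borel_measurable M" and eq: "AE x in M. f x = g x"
  shows "g \<in> borel_measurable M"
proof (rule measurableI)
  fix A :: "'b set" assume A: "A \<in> sets borel"
  have "f -` A \<inter> space M \<in> sets M" by (rule measurable_sets[OF f A])
  moreover have "AE x in M. x \<in> f -` A \<inter> space M \<longleftrightarrow> x \<in> g -` A \<inter> space M"
    using eq by eventually_elim auto
  ultimately show "g -` A \<inter> space M \<in> sets M"
    using in_sets_AE[of "f -` A \<inter> space M" "g -` A \<inter> space M"] by auto
qed simp

lemma complete_measure_lebesgue_on:
  assumes "S \<in> sets lebesgue"
  shows "complete_measure (lebesgue_on S)"
proof
  fix A B assume "B \<subseteq> A" "A \<in> null_sets (lebesgue_on S)"
  then have A: "A \<in> null_sets lebesgue" "A \<subseteq> S" using assms by (auto simp: null_sets_restrict_space)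
  then have "B \<in> sets lebesgue"
    using \<open>B \<subseteq> A\<close> completion.complete by blast
  with \<open>B \<subseteq> A\<close> A(2) assms show "B \<in> sets (lebesgue_on S)"
    by (simp add: sets_restrict_space_iff)
qed

lemma norm_onD:
  assumes "norm_on X n"
  shows norm_on_subspace: "subspace X"
    and norm_on_nonneg: "x \<in> X \<Longrightarrow> 0 \<le> n x"
    and norm_on_scale: "x \<in> X \<Longrightarrow> n (c *\<^sub>R x) = \<bar>c\<bar> * n x"
    and norm_on_triangle: "x \<in> X \<Longrightarrow> y \<in> X \<Longrightarrow> n (x + y) \<le> n x + n y"
  using assms by (auto simp: norm_on_def)

lemma norm_on_zero: "norm_on X n \<Longrightarrow> n 0 = 0"
  by (metis norm_on_def subspace_0)

lemma norm_on_minus_commute: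
  assumes "norm_on X n" "x \<in> X" "y \<in> X"
  shows "n (x - y) = n (y - x)"
  using norm_on_scale[OF assms(1), of "y - x" "-1"] norm_on_subspace[OF assms(1)] assms
  by (simp add: subspace_diff)

lemma norm_on_reverse_triangle:
  assumes n: "norm_on X n" and xy: "x \<in> X" "y \<in> X"
  shows "\<bar>n x - n y\<bar> \<le> n (x - y)"
proof -
  have X: "x - y \<in> X" "y - x \<in> X" using norm_on_subspace[OF n] xy by (auto simp: subspace_diff)
  show ?thesis
    using norm_on_triangle[OF n X(1) xy(2)] norm_on_triangle[OF n X(2) xy(1)]
      norm_on_minus_commute[OF n xy] by auto
qed

lemma strongly_measurable_on_norm:
  assumes n: "norm_on X n" and M: "complete_measure M" and f: "strongly_measurable_on X n M f"
  shows "(\<lambda>t. n (f t)) \<in> borel_measurable M"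
proof -
  interpret complete_measure M by fact
  obtain s :: "nat \<Rightarrow> 'b \<Rightarrow> 'a" where s: "\<And>i. simple_function M (s i)" "\<And>i. s i \<in> space M \<rightarrow> X"
    and lim: "AE t in M. (\<lambda>i. n (f t - s i t)) \<longlonglongrightarrow> 0" and fX: "f \<in> space M \<rightarrow> X"
    using f by (auto simp: strongly_measurable_on_def)
  have [measurable]: "(\<lambda>t. n (s i t)) \<in> borel_measurable M" for i
    by (rule borel_measurable_simple_function[OF simple_function_compose1[OF s(1)]])
  have "(\<lambda>t. lim (\<lambda>i. n (s i t))) \<in> borel_measurable M" by measurable
  moreover have "AE t in M. lim (\<lambda>i. n (s i t)) = n (f t)"
    using lim AE_space
  proof eventually_elim
    case (elim t)
    have "(\<lambda>i. n (s i t) - n (f t)) \<longlonglongrightarrow> 0"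
    proof (rule Lim_null_comparison[OF _ elim(1)])
      show "\<forall>\<^sub>F i in sequentially. norm (n (s i t) - n (f t)) \<le> n (f t - s i t)"
        using norm_on_reverse_triangle[OF n, of "f t" "s _ t"] elim(2) fX s(2)
        by (intro always_eventually allI) (auto simp: abs_minus_commute Pi_iff)
    qed
    then have "(\<lambda>i. n (s i t)) \<longlonglongrightarrow> n (f t)" by (rule LIM_zero_cancel)
    then show ?case by (rule limI)
  qed
  ultimately show ?thesis by (rule borel_measurable_AE_cong)
qed

lemma strongly_measurable_on_diff_simple:
  assumes n: "norm_on X n" and f: "strongly_measurable_on X n M f"
    and g: "simple_function M g" "g \<in> space M \<rightarrow> X"
  shows "strongly_measurable_on X n M (\<lambda>t. f t - g t)"
proof -
  obtain s :: "nat \<Rightarrow> 'b \<Rightarrow> 'a" where s: "\<And>i. simple_function M (s i)" "\<And>i. s i \<in> space M \<rightarrow> X"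
    and lim: "AE t in M. (\<lambda>i. n (f t - s i t)) \<longlonglongrightarrow> 0" and fX: "f \<in> space M \<rightarrow> X"
    using f by (auto simp: strongly_measurable_on_def)
  show ?thesis
    unfolding strongly_measurable_on_def
  proof (intro conjI exI[of _ "\<lambda>i t. s i t - g t"] allI)
    show "(\<lambda>t. f t - g t) \<in> space M \<rightarrow> X"
      using fX g norm_on_subspace[OF n] by (auto simp: Pi_iff intro: subspace_diff)
    show "AE t in M. (\<lambda>i. n (f t - g t - (s i t - g t))) \<longlonglongrightarrow> 0"
      using lim by simp
    show "simple_function M (\<lambda>t. s i t - g t)" for i
      by (rule simple_function_compose2) fact+
    show "(\<lambda>t. s i t - g t) \<in> space M \<rightarrow> X" for i
      using s(2)[of i] g norm_on_subspace[OF n] by (auto simp: Pi_iff intro: subspace_diff)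
  qed
qed

text \<open>
  The approximation half of the Bochner integral, with the integrable distance \<open>n (g t - s i t)\<close> replaced
  by a measurable majorant \<open>e i\<close>.  Majorants of two functions add up to a majorant for the sum, so
  linearity holds without any discussion of the measurability of the sum.
\<close>

definition bochner_majorized ::
  "'v::real_vector set \<Rightarrow> ('v \<Rightarrow> real) \<Rightarrow> 'a measure \<Rightarrow> ('a \<Rightarrow> 'v) \<Rightarrow> 'v \<Rightarrow> bool" where
  "bochner_majorized X n M g z \<longleftrightarrow> g \<in> space M \<rightarrow> X \<and> z \<in> X \<and> (\<exists>s e.
     (\<forall>i. Bochner_Integration.simple_bochner_integrable M (s i) \<and> s i \<in> space M \<rightarrow> X) \<and>
     (\<forall>i. e i \<in> borel_measurable M) \<and>
     (\<forall>i. \<forall>t\<in>space M. ennreal (n (g t - s i t)) \<le> e i t) \<and>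
     (\<lambda>i :: nat. \<integral>\<^sup>+t. e i t \<partial>M) \<longlonglongrightarrow> 0 \<and>
     (\<lambda>i. n (Bochner_Integration.simple_bochner_integral M (s i) - z)) \<longlonglongrightarrow> 0)"

lemma has_bochner_integral_on_majorized:
  assumes n: "norm_on X n" and M: "complete_measure M" and int: "has_bochner_integral_on X n M g z"
  shows "bochner_majorized X n M g z"
proof -
  obtain s where sm: "strongly_measurable_on X n M g" and z: "z \<in> X"
    and s: "\<And>i. Bochner_Integration.simple_bochner_integrable M (s i)" "\<And>i. s i \<in> space M \<rightarrow> X"
    and lim: "(\<lambda>i :: nat. \<integral>\<^sup>+t. ennreal (n (g t - s i t)) \<partial>M) \<longlonglongrightarrow> 0"
      "(\<lambda>i. n (Bochner_Integration.simple_bochner_integral M (s i) - z)) \<longlonglongrightarrow> 0"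
    using int unfolding has_bochner_integral_on_def by blast
  have "(\<lambda>t. ennreal (n (g t - s i t))) \<in> borel_measurable M" for i
    using strongly_measurable_on_norm[OF n M strongly_measurable_on_diff_simple[OF n sm _ s(2)]] s(1)[of i]
    by (auto simp: simple_bochner_integrable.simps)
  with sm z s lim show ?thesis
    unfolding bochner_majorized_def strongly_measurable_on_def
    by (intro conjI exI[of _ s] exI[of _ "\<lambda>i t. ennreal (n (g t - s i t))"]) auto
qed

lemma simple_bochner_integral_in_subspace:
  assumes "subspace X" "s \<in> space M \<rightarrow> X"
  shows "Bochner_Integration.simple_bochner_integral M s \<in> X"
  unfolding simple_bochner_integral_def
  by (intro subspace_sum subspace_scale assms) (use assms in auto)

lemma bochner_majorized_add:
  assumes n: "norm_on X n" and g: "bochner_majorized X n M g z" and h: "bochner_majorized X n M h y"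
  shows "bochner_majorized X n M (\<lambda>t. g t + h t) (z + y)"
proof -
  note X = norm_on_subspace[OF n]
  let ?I = "Bochner_Integration.simple_bochner_integral M"
  obtain s e where gX: "g \<in> space M \<rightarrow> X" "z \<in> X"
    and s: "\<And>i. Bochner_Integration.simple_bochner_integrable M (s i)" "\<And>i. s i \<in> space M \<rightarrow> X"
    and e[measurable]: "\<And>i. e i \<in> borel_measurable M"
    and es: "\<And>i t. t \<in> space M \<Longrightarrow> ennreal (n (g t - s i t)) \<le> e i t"
    and le: "(\<lambda>i :: nat. \<integral>\<^sup>+t. e i t \<partial>M) \<longlonglongrightarrow> 0" and ls: "(\<lambda>i. n (?I (s i) - z)) \<longlonglongrightarrow> 0"
    using g unfolding bochner_majorized_def by blast
  obtain r d where hX: "h \<in> space M \<rightarrow> X" "y \<in> X"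
    and r: "\<And>i. Bochner_Integration.simple_bochner_integrable M (r i)" "\<And>i. r i \<in> space M \<rightarrow> X"
    and d[measurable]: "\<And>i. d i \<in> borel_measurable M"
    and dr: "\<And>i t. t \<in> space M \<Longrightarrow> ennreal (n (h t - r i t)) \<le> d i t"
    and ld: "(\<lambda>i :: nat. \<integral>\<^sup>+t. d i t \<partial>M) \<longlonglongrightarrow> 0" and lr: "(\<lambda>i. n (?I (r i) - y)) \<longlonglongrightarrow> 0"
    using h unfolding bochner_majorized_def by blast
  have tri: "n (a + b - (a' + b')) \<le> n (a - a') + n (b - b')"
    if "a \<in> X" "b \<in> X" "a' \<in> X" "b' \<in> X" for a b a' b'
    using norm_on_triangle[OF n, of "a - a'" "b - b'"] X that by (simp add: subspace_diff add_diff_add)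
  show ?thesis
    unfolding bochner_majorized_def
  proof (intro conjI exI[of _ "\<lambda>i t. s i t + r i t"] exI[of _ "\<lambda>i t. e i t + d i t"] allI ballI)
    show "(\<lambda>t. g t + h t) \<in> space M \<rightarrow> X" "z + y \<in> X"
      using gX hX X by (auto intro: subspace_add)
    show "Bochner_Integration.simple_bochner_integrable M (\<lambda>t. s i t + r i t)" for i
      by (rule simple_bochner_integrable_compose2) (use s r in auto)
    show "(\<lambda>t. s i t + r i t) \<in> space M \<rightarrow> X" for i
      using s(2)[of i] r(2)[of i] X by (auto intro: subspace_add)
    show "(\<lambda>t. e i t + d i t) \<in> borel_measurable M" for i by measurable
    show "ennreal (n (g t + h t - (s i t + r i t))) \<le> e i t + d i t" if t: "t \<in> space M" for i t
    proof -
      have m: "g t \<in> X" "h t \<in> X" "s i t \<in> X" "r i t \<in> X"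
        using t gX hX s(2)[of i] r(2)[of i] by auto
      then have "ennreal (n (g t + h t - (s i t + r i t))) \<le> ennreal (n (g t - s i t) + n (h t - r i t))"
        by (intro ennreal_leI tri)
      also have "\<dots> = ennreal (n (g t - s i t)) + ennreal (n (h t - r i t))"
        using m X by (intro ennreal_plus norm_on_nonneg[OF n]) (auto intro: subspace_diff)
      also have "\<dots> \<le> e i t + d i t" by (intro add_mono es dr t)
      finally show ?thesis .
    qed
    show "(\<lambda>i. \<integral>\<^sup>+t. e i t + d i t \<partial>M) \<longlonglongrightarrow> 0"
      using tendsto_add[OF le ld] by (simp add: nn_integral_add)
    have inX: "?I (s i) \<in> X" "?I (r i) \<in> X" for i
      by (intro simple_bochner_integral_in_subspace X s r)+
    have lim0: "(\<lambda>i. n (?I (s i) - z) + n (?I (r i) - y)) \<longlonglongrightarrow> 0"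
      using tendsto_add[OF ls lr] by simp
    show "(\<lambda>i. n (?I (\<lambda>t. s i t + r i t) - (z + y))) \<longlonglongrightarrow> 0"
    proof (rule Lim_null_comparison[OF _ lim0], intro always_eventually allI)
      fix i
      have "0 \<le> n (?I (s i) + ?I (r i) - (z + y))"
        using inX gX hX X by (intro norm_on_nonneg[OF n]) (auto intro: subspace_diff subspace_add)
      then show "norm (n (?I (\<lambda>t. s i t + r i t) - (z + y))) \<le> n (?I (s i) - z) + n (?I (r i) - y)"
        using tri[OF inX gX(2) hX(2)] by (simp add: simple_bochner_integral_add s r)
    qed
  qed
qed

lemma bochner_majorized_scaleR_const:
  fixes \<phi> :: "'a \<Rightarrow> real"
  assumes n: "norm_on X n" and v: "v \<in> X" and \<phi>: "has_bochner_integral M \<phi> k"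
  shows "bochner_majorized X n M (\<lambda>t. \<phi> t *\<^sub>R v) (k *\<^sub>R v)"
proof -
  note X = norm_on_subspace[OF n]
  have \<phi>m[measurable]: "\<phi> \<in> borel_measurable M"
    using \<phi> by (rule borel_measurable_has_bochner_integral)
  from \<phi> obtain s where s: "\<And>i. Bochner_Integration.simple_bochner_integrable M (s i)"
    and lim: "(\<lambda>i. \<integral>\<^sup>+x. norm (\<phi> x - s i x) \<partial>M) \<longlonglongrightarrow> 0"
      "(\<lambda>i. Bochner_Integration.simple_bochner_integral M (s i)) \<longlonglongrightarrow> k"
    by (auto simp: has_bochner_integral.simps)
  have [measurable]: "s i \<in> borel_measurable M" for i
    using s[of i] by (auto simp: simple_bochner_integrable.simps intro: borel_measurable_simple_function)
  have eq: "n (a *\<^sub>R v - b *\<^sub>R v) = norm (a - b) * n v" for a b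
    using norm_on_scale[OF n v, of "a - b"] by (simp add: scaleR_left_diff_distrib)
  note nv = norm_on_nonneg[OF n v]
  show ?thesis
    unfolding bochner_majorized_def
  proof (intro conjI exI[of _ "\<lambda>i t. s i t *\<^sub>R v"] exI[of _ "\<lambda>i t. ennreal (norm (\<phi> t - s i t)) * ennreal (n v)"] allI ballI)
    show "(\<lambda>t. \<phi> t *\<^sub>R v) \<in> space M \<rightarrow> X" "k *\<^sub>R v \<in> X" "(\<lambda>t. s i t *\<^sub>R v) \<in> space M \<rightarrow> X" for i
      using v X by (auto intro: subspace_scale)
    show "Bochner_Integration.simple_bochner_integrable M (\<lambda>t. s i t *\<^sub>R v)" for i
      by (rule simple_bochner_integrable_compose2[where p = "\<lambda>a _. a *\<^sub>R v", OF _ s s]) simp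
    show "(\<lambda>t. ennreal (norm (\<phi> t - s i t)) * ennreal (n v)) \<in> borel_measurable M" for i
      by measurable
    show "ennreal (n (\<phi> t *\<^sub>R v - s i t *\<^sub>R v)) \<le> ennreal (norm (\<phi> t - s i t)) * ennreal (n v)" for i t
      unfolding eq by (subst ennreal_mult) (use nv in auto)
    show "(\<lambda>i. \<integral>\<^sup>+t. ennreal (norm (\<phi> t - s i t)) * ennreal (n v) \<partial>M) \<longlonglongrightarrow> 0"
      using ennreal_tendsto_cmult[OF _ lim(1), of "ennreal (n v)"]
      by (simp add: nn_integral_multc mult.commute[of _ "ennreal (n v)"] nn_integral_cmult)
    have "(\<lambda>i. norm (Bochner_Integration.simple_bochner_integral M (s i) - k) * n v) \<longlonglongrightarrow> norm (k - k) * n v"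
      by (intro tendsto_intros lim)
    moreover have "Bochner_Integration.simple_bochner_integral M (\<lambda>t. s i t *\<^sub>R v)
        = Bochner_Integration.simple_bochner_integral M (s i) *\<^sub>R v" for i
      by (rule simple_bochner_integral_linear[OF _ s])
         (auto intro!: linearI simp: scaleR_left_distrib)
    ultimately show "(\<lambda>i. n (Bochner_Integration.simple_bochner_integral M (\<lambda>t. s i t *\<^sub>R v) - k *\<^sub>R v)) \<longlonglongrightarrow> 0"
      by (simp add: eq)
  qed
qed

text \<open>
  The triangle inequality for a sublinear functional \<open>q\<close> dominated by the norm: it holds for simple
  functions, and both errors of the approximation are controlled by \<open>n\<close>.  It is used for the
  K-functional, whose values on \<open>X0\<close> can then be estimated by \<open>n0\<close> although the integral lives in \<open>X1\<close>.
\<close>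

lemma bochner_majorized_seminorm_le:
  assumes n: "norm_on X n" and g: "bochner_majorized X n M g z"
    and qadd: "\<And>x y. x \<in> X \<Longrightarrow> y \<in> X \<Longrightarrow> q (x + y) \<le> q x + q y"
    and qscale: "\<And>c x. 0 \<le> c \<Longrightarrow> x \<in> X \<Longrightarrow> q (c *\<^sub>R x) \<le> c * q x"
    and qnn: "\<And>x. x \<in> X \<Longrightarrow> 0 \<le> q x"
    and qle: "\<And>x. x \<in> X \<Longrightarrow> q x \<le> C * n x" and C: "0 \<le> C"
    and b[measurable]: "b \<in> borel_measurable M"
    and qb: "\<And>t. t \<in> space M \<Longrightarrow> ennreal (q (g t)) \<le> b t"
  shows "ennreal (q z) \<le> (\<integral>\<^sup>+t. b t \<partial>M)"
proof -
  note X = norm_on_subspace[OF n]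
  let ?I = "Bochner_Integration.simple_bochner_integral M"
  obtain s e where gX: "g \<in> space M \<rightarrow> X" "z \<in> X"
    and s: "\<And>i. Bochner_Integration.simple_bochner_integrable M (s i)" "\<And>i. s i \<in> space M \<rightarrow> X"
    and e[measurable]: "\<And>i. e i \<in> borel_measurable M"
    and es: "\<And>i t. t \<in> space M \<Longrightarrow> ennreal (n (g t - s i t)) \<le> e i t"
    and le: "(\<lambda>i :: nat. \<integral>\<^sup>+t. e i t \<partial>M) \<longlonglongrightarrow> 0" and ls: "(\<lambda>i. n (?I (s i) - z)) \<longlonglongrightarrow> 0"
    using g unfolding bochner_majorized_def by blast
  have q0: "q 0 = 0" using qscale[of 0 0] qnn[of 0] subspace_0[OF X] by simp
  have qsum: "q (\<Sum>y\<in>A. c y *\<^sub>R y) \<le> (\<Sum>y\<in>A. c y * q y)"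
    if "finite A" "A \<subseteq> X" "\<And>y. 0 \<le> c y" for A c
    using that(1,2)
  proof (induction A)
    case (insert a A)
    have "q (\<Sum>y\<in>insert a A. c y *\<^sub>R y) \<le> q (c a *\<^sub>R a) + q (\<Sum>y\<in>A. c y *\<^sub>R y)"
      using insert by (auto intro!: qadd subspace_sum subspace_scale X)
    also have "\<dots> \<le> c a * q a + (\<Sum>y\<in>A. c y * q y)"
      using insert that(3) by (intro add_mono qscale) auto
    finally show ?case using insert by simp
  qed (simp add: q0)
  \<comment> \<open>\<open>z\<close> is compared with the integral of \<open>s i\<close>, and \<open>s i\<close> with \<open>g\<close>\<close>
  have bound: "ennreal (q z) \<le> ennreal (C * n (?I (s i) - z)) + ((\<integral>\<^sup>+t. b t \<partial>M) + ennreal C * (\<integral>\<^sup>+t. e i t \<partial>M))" for i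
  proof -
    have fin: "finite (s i ` space M)"
      using s(1)[of i] by (auto simp: simple_bochner_integrable.simps simple_function_def)
    have IX: "?I (s i) \<in> X" by (intro simple_bochner_integral_in_subspace X s)
    define \<psi> where "\<psi> = (\<lambda>t. max 0 (q (s i t)))"
    have \<psi>: "Bochner_Integration.simple_bochner_integrable M \<psi>"
      unfolding \<psi>_def
      by (rule simple_bochner_integrable_compose2[where p = "\<lambda>a _. max 0 (q a)", OF _ s(1) s(1)]) (simp add: q0)
    have "q (?I (s i)) \<le> (\<Sum>y\<in>s i ` space M. measure M {x\<in>space M. s i x = y} * q y)"
      unfolding simple_bochner_integral_def by (rule qsum) (use fin s(2)[of i] in auto)
    also have "\<dots> = (\<Sum>y\<in>s i ` space M. measure M {x\<in>space M. s i x = y} *\<^sub>R max 0 (q y))"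
      using s(2)[of i] qnn by (intro sum.cong) (auto simp: max_def)
    also have "\<dots> = ?I \<psi>"
      by (rule simple_bochner_integral_partition[OF \<psi>, symmetric])
         (use s(1)[of i] in \<open>auto simp: \<psi>_def simple_bochner_integrable.simps\<close>)
    finally have "ennreal (q (?I (s i))) \<le> ennreal (?I \<psi>)" by (rule ennreal_leI)
    also have "\<dots> = (\<integral>\<^sup>+t. ennreal (\<psi> t) \<partial>M)"
      by (rule simple_bochner_integral_eq_nn_integral[OF \<psi>]) (simp add: \<psi>_def)
    also have "\<dots> \<le> (\<integral>\<^sup>+t. b t + ennreal C * e i t \<partial>M)"
    proof (rule nn_integral_mono)
      fix t assume t: "t \<in> space M"
      then have m: "g t \<in> X" "s i t \<in> X" using gX s(2)[of i] by auto
      then have m': "s i t - g t \<in> X" "g t - s i t \<in> X" using X by (auto intro: subspace_diff)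
      have "q (s i t) \<le> q (g t) + q (s i t - g t)"
        using qadd[OF m(1) m'(1)] by simp
      also have "\<dots> \<le> q (g t) + C * n (g t - s i t)"
        using qle[OF m'(1)] norm_on_minus_commute[OF n m] by simp
      finally have "ennreal (q (s i t)) \<le> ennreal (q (g t) + C * n (g t - s i t))" by (rule ennreal_leI)
      also have "\<dots> = ennreal (q (g t)) + ennreal C * ennreal (n (g t - s i t))"
        using qnn[OF m(1)] norm_on_nonneg[OF n m'(2)] C by (simp add: ennreal_mult)
      also have "\<dots> \<le> b t + ennreal C * e i t"
        using t by (intro add_mono mult_left_mono qb es) auto
      finally show "ennreal (\<psi> t) \<le> b t + ennreal C * e i t"
        using qnn[OF m(2)] by (simp add: \<psi>_def max_def)
    qed
    also have "\<dots> = (\<integral>\<^sup>+t. b t \<partial>M) + ennreal C * (\<integral>\<^sup>+t. e i t \<partial>M)"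
      by (simp add: nn_integral_add nn_integral_cmult)
    finally have 1: "ennreal (q (?I (s i))) \<le> (\<integral>\<^sup>+t. b t \<partial>M) + ennreal C * (\<integral>\<^sup>+t. e i t \<partial>M)" .
    have zI: "z - ?I (s i) \<in> X" "?I (s i) - z \<in> X" using gX IX X by (auto intro: subspace_diff)
    have "q z \<le> q (z - ?I (s i)) + q (?I (s i))" using qadd[OF zI(1) IX] by simp
    also have "\<dots> \<le> C * n (?I (s i) - z) + q (?I (s i))"
      using qle[OF zI(1)] norm_on_minus_commute[OF n gX(2) IX] by simp
    finally have "ennreal (q z) \<le> ennreal (C * n (?I (s i) - z) + q (?I (s i)))" by (rule ennreal_leI)
    also have "\<dots> = ennreal (C * n (?I (s i) - z)) + ennreal (q (?I (s i)))"
      using C norm_on_nonneg[OF n zI(2)] qnn[OF IX] by simp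
    also have "\<dots> \<le> ennreal (C * n (?I (s i) - z)) + ((\<integral>\<^sup>+t. b t \<partial>M) + ennreal C * (\<integral>\<^sup>+t. e i t \<partial>M))"
      by (intro add_mono 1) simp
    finally show ?thesis .
  qed
  have "(\<lambda>i. ennreal (C * n (?I (s i) - z)) + ((\<integral>\<^sup>+t. b t \<partial>M) + ennreal C * (\<integral>\<^sup>+t. e i t \<partial>M)))
     \<longlonglongrightarrow> ennreal (C * 0) + ((\<integral>\<^sup>+t. b t \<partial>M) + ennreal C * 0)"
    by (intro tendsto_add tendsto_const tendsto_ennrealI tendsto_mult ls ennreal_tendsto_cmult le) auto
  then show ?thesis
    by (intro LIMSEQ_le_const[where X = "\<lambda>i. ennreal (C * n (?I (s i) - z)) + ((\<integral>\<^sup>+t. b t \<partial>M) + ennreal C * (\<integral>\<^sup>+t. e i t \<partial>M))"])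
       (auto intro: bound)
qed
section \<open>The K-functional as a norm on the larger space\<close>

locale normed_couple =
  fixes X0 :: "'v::real_vector set" and n0 X1 n1
  assumes n0: "norm_on X0 n0" and n1: "norm_on X1 n1" and X01: "X0 \<subseteq> X1"
begin

definition K :: "real \<Rightarrow> 'v \<Rightarrow> real" where
  "K t a = K_fun t a X0 n0 X1 n1"

definition costs :: "real \<Rightarrow> 'v \<Rightarrow> real set" where
  "costs t a = {n0 a0 + t * n1 a1 | a0 a1. a0 \<in> X0 \<and> a1 \<in> X1 \<and> a = a0 + a1}"

lemma K_eq_Inf: "K t a = Inf (costs t a)"
  by (simp add: K_def K_fun_def costs_def)

lemma costsI: "a0 \<in> X0 \<Longrightarrow> a1 \<in> X1 \<Longrightarrow> n0 a0 + t * n1 a1 \<in> costs t (a0 + a1)"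
  by (auto simp: costs_def)

lemma costs_nonneg: "0 \<le> t \<Longrightarrow> x \<in> costs t a \<Longrightarrow> 0 \<le> x"
  using norm_on_nonneg[OF n0] norm_on_nonneg[OF n1] by (auto simp: costs_def)

lemma costs_bdd: "0 \<le> t \<Longrightarrow> bdd_below (costs t a)"
  using costs_nonneg by (intro bdd_belowI[of _ 0])

lemma n1_mem_costs: "a \<in> X1 \<Longrightarrow> t * n1 a \<in> costs t a"
  using costsI[OF subspace_0[OF norm_on_subspace[OF n0]], of a t] norm_on_zero[OF n0] by simp

lemma K_le_cost: "0 \<le> t \<Longrightarrow> x \<in> costs t a \<Longrightarrow> K t a \<le> x"
  unfolding K_eq_Inf by (intro cInf_lower costs_bdd)

lemma K_greatest: "a \<in> X1 \<Longrightarrow> (\<And>x. x \<in> costs t a \<Longrightarrow> y \<le> x) \<Longrightarrow> y \<le> K t a"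
  unfolding K_eq_Inf using n1_mem_costs[of a t] by (intro cInf_greatest) auto

lemma K_nonneg: "0 \<le> t \<Longrightarrow> a \<in> X1 \<Longrightarrow> 0 \<le> K t a"
  by (rule K_greatest) (auto intro: costs_nonneg)

lemma K_le_n1: "0 \<le> t \<Longrightarrow> a \<in> X1 \<Longrightarrow> K t a \<le> t * n1 a"
  by (intro K_le_cost n1_mem_costs)

lemma K_le_n0:
  assumes "0 \<le> t" "a \<in> X0" shows "K t a \<le> n0 a"
proof (rule K_le_cost)
  show "n0 a \<in> costs t a"
    using costsI[OF assms(2) subspace_0[OF norm_on_subspace[OF n1]], of t] norm_on_zero[OF n1] by simp
qed fact

lemma K_add:
  assumes t: "0 \<le> t" and ab: "a \<in> X1" "b \<in> X1"
  shows "K t (a + b) \<le> K t a + K t b"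
proof -
  have "K t (a + b) \<le> x + y" if xy: "x \<in> costs t a" "y \<in> costs t b" for x y
  proof -
    obtain a0 a1 b0 b1 where *: "a0 \<in> X0" "a1 \<in> X1" "a = a0 + a1" "x = n0 a0 + t * n1 a1"
      "b0 \<in> X0" "b1 \<in> X1" "b = b0 + b1" "y = n0 b0 + t * n1 b1"
      using xy by (auto simp: costs_def)
    have "n0 (a0 + b0) + t * n1 (a1 + b1) \<in> costs t ((a0 + b0) + (a1 + b1))"
      using * norm_on_subspace[OF n0] norm_on_subspace[OF n1] by (intro costsI subspace_add)
    also have "(a0 + b0) + (a1 + b1) = a + b" using * by simp
    finally have "n0 (a0 + b0) + t * n1 (a1 + b1) \<in> costs t (a + b)" .
    then have "K t (a + b) \<le> n0 (a0 + b0) + t * n1 (a1 + b1)" by (rule K_le_cost[OF t])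
    also have "\<dots> \<le> (n0 a0 + n0 b0) + t * (n1 a1 + n1 b1)"
      using * t by (intro add_mono mult_left_mono norm_on_triangle[OF n0] norm_on_triangle[OF n1])
    finally show ?thesis using * by (simp add: algebra_simps)
  qed
  then have "K t (a + b) - y \<le> K t a" if "y \<in> costs t b" for y
    using that ab by (intro K_greatest) (auto simp: algebra_simps)
  then have "K t (a + b) - K t a \<le> K t b"
    using ab by (intro K_greatest) (auto simp: algebra_simps)
  then show ?thesis by simp
qed

lemma K_scale_le:
  assumes t: "0 \<le> t" and c: "0 \<le> c" and a: "a \<in> X1"
  shows "K t (c *\<^sub>R a) \<le> c * K t a"
proof (cases "c = 0")
  case True
  then show ?thesis
    using K_le_n0[OF t subspace_0[OF norm_on_subspace[OF n0]]] norm_on_zero[OF n0] by simp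
next
  case False
  with c have c0: "0 < c" by simp
  have "K t (c *\<^sub>R a) / c \<le> K t a"
  proof (rule K_greatest[OF a])
    fix x assume "x \<in> costs t a"
    then obtain a0 a1 where *: "a0 \<in> X0" "a1 \<in> X1" "a = a0 + a1" "x = n0 a0 + t * n1 a1"
      by (auto simp: costs_def)
    have "n0 (c *\<^sub>R a0) + t * n1 (c *\<^sub>R a1) \<in> costs t (c *\<^sub>R a0 + c *\<^sub>R a1)"
      using * norm_on_subspace[OF n0] norm_on_subspace[OF n1] by (intro costsI subspace_scale)
    then have "c * x \<in> costs t (c *\<^sub>R a)"
      using * norm_on_scale[OF n0 *(1), of c] norm_on_scale[OF n1 *(2), of c] c
      by (simp add: algebra_simps)
    then have "K t (c *\<^sub>R a) \<le> c * x" by (rule K_le_cost[OF t])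
    then show "K t (c *\<^sub>R a) / c \<le> x" using c0 by (simp add: field_simps)
  qed
  then show ?thesis using c0 by (simp add: field_simps)
qed

lemma K_scale:
  assumes t: "0 \<le> t" and c: "0 < c" and a: "a \<in> X1"
  shows "K t (c *\<^sub>R a) = c * K t a"
proof -
  have "c *\<^sub>R a \<in> X1" using norm_on_subspace[OF n1] a by (rule subspace_scale)
  from K_scale_le[OF t _ this, of "1 / c"] K_scale_le[OF t _ a, of c] c
  show ?thesis by (simp add: field_simps)
qed
text \<open>
  The converse of \<open>K_le_n1\<close> up to a constant: the embedding measures both parts of a decomposition in
  the larger space.
\<close>

lemma n1_le_K:
  assumes emb: "\<And>a. a \<in> X0 \<Longrightarrow> n1 a \<le> C * n0 a" and t: "0 < t" and a: "a \<in> X1"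
  shows "n1 a \<le> max \<bar>C\<bar> (1 / t) * K t a"
proof -
  define D where "D = max \<bar>C\<bar> (1 / t)"
  have D: "0 < D" "\<bar>C\<bar> \<le> D" "1 \<le> D * t" using t by (auto simp: D_def max_def field_simps)
  have "n1 a / D \<le> K t a"
  proof (rule K_greatest[OF a])
    fix x assume "x \<in> costs t a"
    then obtain a0 a1 where *: "a0 \<in> X0" "a1 \<in> X1" "a = a0 + a1" "x = n0 a0 + t * n1 a1"
      by (auto simp: costs_def)
    have "n1 a \<le> n1 a0 + n1 a1" using * X01 by (auto intro: norm_on_triangle[OF n1])
    also have "n1 a0 \<le> D * n0 a0"
      using emb[OF *(1)] D norm_on_nonneg[OF n0 *(1)] mult_right_mono[of C D "n0 a0"] by linarith
    also have "n1 a1 \<le> D * t * n1 a1" using D norm_on_nonneg[OF n1 *(2)] mult_right_mono[of 1 "D * t" "n1 a1"] by simp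
    finally show "n1 a / D \<le> x" using D * by (simp add: field_simps)
  qed
  then show ?thesis using D by (simp add: field_simps flip: D_def)
qed

end

section \<open>Averaged bound for the K-functional\<close>

locale kernel_and_couple = convolution_kernel \<kappa> + normed_couple X0 n0 X1 n1
  for \<kappa> and X0 :: "'v::real_vector set" and n0 X1 n1
begin

text \<open>
  Adding \<open>\<kappa> (x - s) *\<^sub>R u0\<close> to the integrand of the equation shows that \<open>kint x *\<^sub>R u0\<close> is the integral of
  \<open>\<kappa> (x - s) *\<^sub>R u s\<close> minus that of \<open>f\<close>, both taken in \<open>X1\<close>.  Since \<open>K \<tau>\<close> is at most \<open>n0\<close> on \<open>X0\<close> and at most
  \<open>\<tau> * n1\<close> on \<open>X1\<close>, the triangle inequality for \<open>K \<tau>\<close> under the integral bounds the first part by the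
  norms of \<open>u\<close> in \<open>X0\<close> although its integral is formed in \<open>X1\<close>.
\<close>

lemma convolution_K_bound:
  assumes x: "0 < x" and \<tau>: "0 < \<tau>"
    and u: "\<And>s. s \<in> {0<..<x} \<Longrightarrow> u s \<in> X0"
    and um: "(\<lambda>s. n0 (u s)) \<in> borel_measurable (lebesgue_on {0<..<x})"
    and u0: "u0 \<in> X1"
    and conv: "has_bochner_integral_on X1 n1 (lebesgue_on {0<..<x}) (\<lambda>s. \<kappa> (x - s) *\<^sub>R (u s - u0)) z"
    and prim: "has_bochner_integral_on X1 n1 (lebesgue_on {0<..<x}) f z"
  shows "ennreal (K \<tau> u0) * kint x \<le>
    (\<integral>\<^sup>+s. ennreal (\<kappa> (x - s)) * indicator {0<..<x} s * ennreal (n0 (u s)) \<partial>lebesgue) +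
    ennreal \<tau> * (\<integral>\<^sup>+s. ennreal (n1 (f s)) * indicator {0<..<x} s \<partial>lebesgue)"
proof -
  let ?M = "lebesgue_on {0<..<x}"
  have comp: "complete_measure ?M" by (rule complete_measure_lebesgue_on) simp
  note X1 = norm_on_subspace[OF n1] and X0 = norm_on_subspace[OF n0]
  define k where "k = enn2real (kint x)"
  have k: "kint x = ennreal k" using kint_finite[of x] by (simp add: k_def)
  have k0: "0 < k"
  proof -
    have "ennreal (x * \<kappa> x) \<le> ennreal k" using kint_ge[OF x] k by simp
    moreover have "0 < x * \<kappa> x" using x kappa_pos by simp
    ultimately show ?thesis by (metis ennreal_le_iff2 not_le order.strict_trans2)
  qed
  have \<phi>m: "(\<lambda>s. \<kappa> (x - s)) \<in> borel_measurable ?M"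
  proof -
    have "(\<lambda>s. indicator {0<..} (x - s) * \<kappa> (x - s)) \<in> borel_measurable borel"
      by (rule measurable_compose[OF _ kappa_measurable]) simp
    then have "(\<lambda>s. indicator {0<..} (x - s) * \<kappa> (x - s)) \<in> borel_measurable ?M"
      by (intro measurable_restrict_space1 measurable_completion) simp
    then show ?thesis
      by (rule measurable_cong[THEN iffD1, rotated]) (auto simp: space_restrict_space)
  qed
  have "has_bochner_integral ?M (\<lambda>s. \<kappa> (x - s)) k"
  proof (rule has_bochner_integral_nn_integral[OF \<phi>m])
    show "AE s in ?M. 0 \<le> \<kappa> (x - s)"
      by (rule AE_I2) (auto simp: space_restrict_space intro!: less_imp_le kappa_pos)
    show "0 \<le> k" using k0 by simp
    show "(\<integral>\<^sup>+s. ennreal (\<kappa> (x - s)) \<partial>?M) = ennreal k"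
      by (simp add: nn_integral_restrict_space nn_integral_completion kint_reflect k)
  qed
  note const = bochner_majorized_scaleR_const[OF n1 u0 this]
  note cv = has_bochner_integral_on_majorized[OF n1 comp conv]
  have zX: "z \<in> X1" using cv by (simp add: bochner_majorized_def)
  then have mzX: "- z \<in> X1" using X1 by (simp add: subspace_neg)
  have kuX: "k *\<^sub>R u0 \<in> X1" using u0 X1 by (simp add: subspace_scale)
  have \<kappa>u: "\<kappa> (x - s) *\<^sub>R (u s - u0) + \<kappa> (x - s) *\<^sub>R u0 = \<kappa> (x - s) *\<^sub>R u s" for s
    by (simp add: scaleR_diff_right)
  have "ennreal (K \<tau> (z + k *\<^sub>R u0)) \<le> (\<integral>\<^sup>+s. ennreal (\<kappa> (x - s)) * ennreal (n0 (u s)) \<partial>?M)"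
  proof (rule bochner_majorized_seminorm_le[OF n1 bochner_majorized_add[OF n1 cv const]])
    show "K \<tau> (a + b) \<le> K \<tau> a + K \<tau> b" if "a \<in> X1" "b \<in> X1" for a b
      using that \<tau> by (intro K_add) auto
    show "K \<tau> (c *\<^sub>R a) \<le> c * K \<tau> a" if "0 \<le> c" "a \<in> X1" for c a
      using that \<tau> by (intro K_scale_le) auto
    show "0 \<le> K \<tau> a" if "a \<in> X1" for a using that \<tau> by (intro K_nonneg) auto
    show "K \<tau> a \<le> \<tau> * n1 a" if "a \<in> X1" for a using that \<tau> by (intro K_le_n1) auto
    show "(\<lambda>s. ennreal (\<kappa> (x - s)) * ennreal (n0 (u s))) \<in> borel_measurable ?M"
      using \<phi>m um by measurable
    fix s assume "s \<in> space ?M"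
    then have s: "s \<in> {0<..<x}" by (simp add: space_restrict_space)
    have "K \<tau> (\<kappa> (x - s) *\<^sub>R u s) \<le> n0 (\<kappa> (x - s) *\<^sub>R u s)"
      using u[OF s] X0 \<tau> by (intro K_le_n0) (auto intro: subspace_scale)
    also have "\<dots> = \<kappa> (x - s) * n0 (u s)"
      using norm_on_scale[OF n0 u[OF s]] kappa_pos[of "x - s"] s by simp
    finally have "ennreal (K \<tau> (\<kappa> (x - s) *\<^sub>R u s)) \<le> ennreal (\<kappa> (x - s)) * ennreal (n0 (u s))"
      using norm_on_nonneg[OF n0 u[OF s]] kappa_pos[of "x - s"] s
      by (subst ennreal_mult[symmetric]) (auto intro!: ennreal_leI)
    then show "ennreal (K \<tau> (\<kappa> (x - s) *\<^sub>R (u s - u0) + \<kappa> (x - s) *\<^sub>R u0)) \<le> ennreal (\<kappa> (x - s)) * ennreal (n0 (u s))"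
      unfolding \<kappa>u .
  qed (use \<tau> in simp)
  also have "(\<integral>\<^sup>+s. ennreal (\<kappa> (x - s)) * ennreal (n0 (u s)) \<partial>?M) =
     (\<integral>\<^sup>+s. ennreal (\<kappa> (x - s)) * indicator {0<..<x} s * ennreal (n0 (u s)) \<partial>lebesgue)" (is "_ = ?U")
    by (simp add: nn_integral_restrict_space mult_ac)
  finally have 1: "ennreal (K \<tau> (z + k *\<^sub>R u0)) \<le> ?U" .
  have fX: "f s \<in> X1" if "s \<in> space ?M" for s
    using prim that by (auto simp: has_bochner_integral_on_def strongly_measurable_on_def)
  have "ennreal (n1 z) \<le> (\<integral>\<^sup>+s. ennreal (n1 (f s)) \<partial>?M)"
  proof (rule bochner_majorized_seminorm_le[OF n1 has_bochner_integral_on_majorized[OF n1 comp prim], where C = 1])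
    have "(\<lambda>s. n1 (f s)) \<in> borel_measurable ?M"
      using prim by (intro strongly_measurable_on_norm[OF n1 comp]) (simp add: has_bochner_integral_on_def)
    then show "(\<lambda>s. ennreal (n1 (f s))) \<in> borel_measurable ?M" by measurable
  qed (use norm_on_triangle[OF n1] norm_on_scale[OF n1] norm_on_nonneg[OF n1] in auto)
  also have "\<dots> = (\<integral>\<^sup>+s. ennreal (n1 (f s)) * indicator {0<..<x} s \<partial>lebesgue)" (is "_ = ?F")
    by (simp add: nn_integral_restrict_space)
  finally have 2: "ennreal (n1 z) \<le> ?F" .
  have "k * K \<tau> u0 = K \<tau> (k *\<^sub>R u0)" using K_scale \<tau> k0 u0 by simp
  also have "k *\<^sub>R u0 = (z + k *\<^sub>R u0) + - z" by simp
  also have "K \<tau> \<dots> \<le> K \<tau> (z + k *\<^sub>R u0) + K \<tau> (- z)"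
    using \<tau> zX mzX kuX X1 by (intro K_add) (auto intro: subspace_add)
  also have "K \<tau> (- z) \<le> \<tau> * n1 (- z)" using \<tau> mzX by (intro K_le_n1) auto
  also have "n1 (- z) = n1 z" using norm_on_scale[OF n1 zX, of "-1"] by simp
  finally have "ennreal (k * K \<tau> u0) \<le> ennreal (K \<tau> (z + k *\<^sub>R u0) + \<tau> * n1 z)"
    by (simp add: ennreal_leI)
  also have "\<dots> = ennreal (K \<tau> (z + k *\<^sub>R u0)) + ennreal \<tau> * ennreal (n1 z)"
    using \<tau> zX kuX X1 norm_on_nonneg[OF n1 zX]
    by (subst ennreal_plus) (auto intro: K_nonneg subspace_add simp: ennreal_mult)
  also have "\<dots> \<le> ?U + ennreal \<tau> * ?F" by (intro add_mono mult_left_mono 1 2) simp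
  finally show ?thesis
    using k k0 K_nonneg[of \<tau> u0] \<tau> u0 by (simp add: ennreal_mult mult.commute)
qed

end

context convolution_kernel
begin

text \<open>
  A bound at one point \<open>x\<close> contains the kernel \<open>\<kappa> (x - s)\<close>, which is singular at \<open>s = x\<close>.  Integrating over
  \<open>x\<close> in \<open>(t / 2, t)\<close> removes the singularity, because after exchanging the integrals \<open>u s\<close> is multiplied by
  at most \<open>kint t\<close>.  On the left, \<open>kint x\<close> is at least \<open>kint t / 2\<close> on that interval, so the factor
  \<open>kint t\<close> cancels and plain averages of the data over \<open>(0, t)\<close> remain.
\<close>

lemma average_convolution_bound:
  fixes U F :: "real \<Rightarrow> ennreal"
  assumes \<tau>: "0 < \<tau>" and t: "t = gen_inverse \<kappa> \<tau>" "t \<le> T"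
    and U: "U \<in> borel_measurable lebesgue" and F: "F \<in> borel_measurable lebesgue"
    and bound: "AE x in lebesgue_on {0<..<T}. a * kint x \<le>
        (\<integral>\<^sup>+s. ennreal (\<kappa> (x - s)) * indicator {0<..<x} s * U s \<partial>lebesgue) +
        ennreal \<tau> * (\<integral>\<^sup>+s. F s * indicator {0<..<x} s \<partial>lebesgue)"
  shows "ennreal (t / 4) * a \<le> (\<integral>\<^sup>+s. (U s + F s) * indicator {0<..<t} s \<partial>lebesgue)"
proof -
  have t0: "0 < t" using gen_inverse_pos[OF \<tau>] t by simp
  have ind[measurable]: "indicator {0<..<t} \<in> borel_measurable lebesgue"
    by (rule borel_measurable_indicator) simp
  note [measurable] = U F
  define k where "k x s = ennreal (indicator {0<..} (x - s) * \<kappa> (x - s)) * indicator {0<..} s * indicator {..<t} x"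
    for x s :: real
  have km: "(\<lambda>(x, s). k x s) \<in> borel_measurable (borel \<Otimes>\<^sub>M borel)"
  proof -
    have [measurable]: "(\<lambda>z :: real \<times> real. indicator {0<..} (fst z - snd z) * \<kappa> (fst z - snd z)) \<in> borel_measurable (borel \<Otimes>\<^sub>M borel)"
      by (rule measurable_compose[OF _ kappa_measurable]) simp
    show ?thesis unfolding k_def case_prod_beta by measurable
  qed
  let ?IU = "\<integral>\<^sup>+s. U s * indicator {0<..<t} s \<partial>lebesgue" and ?IF = "\<integral>\<^sup>+s. F s * indicator {0<..<t} s \<partial>lebesgue"
  have "a * kint t * ennreal (t / 4) \<le> a * (2 * kint (t / 2)) * ennreal (t / 4)"
    by (intro mult_right_mono mult_left_mono kint_half t0) auto
  also have "\<dots> = a * kint (t / 2) * (2 * ennreal (t / 4))" by (simp add: mult_ac)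
  also have "2 * ennreal (t / 4) = ennreal (t / 2)"
    using t0 by (simp flip: ennreal_numeral ennreal_mult)
  also have "a * kint (t / 2) * ennreal (t / 2) = (\<integral>\<^sup>+x. a * kint (t / 2) * indicator {t/2<..<t} x \<partial>lborel)"
    using t0 by (simp add: nn_integral_cmult_indicator)
  also have "\<dots> \<le> (\<integral>\<^sup>+x. (\<integral>\<^sup>+s. k x s * U s \<partial>lebesgue) + ennreal \<tau> * ?IF * indicator {0<..<t} x \<partial>lborel)"
  proof (rule nn_integral_mono_AE)
    have "AE x in lebesgue. x \<in> {0<..<T} \<longrightarrow> a * kint x \<le>
        (\<integral>\<^sup>+s. ennreal (\<kappa> (x - s)) * indicator {0<..<x} s * U s \<partial>lebesgue) +
        ennreal \<tau> * (\<integral>\<^sup>+s. F s * indicator {0<..<x} s \<partial>lebesgue)"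
      using bound by (simp add: AE_restrict_space_iff)
    then have "AE x in lborel. x \<in> {0<..<T} \<longrightarrow> a * kint x \<le>
        (\<integral>\<^sup>+s. ennreal (\<kappa> (x - s)) * indicator {0<..<x} s * U s \<partial>lebesgue) +
        ennreal \<tau> * (\<integral>\<^sup>+s. F s * indicator {0<..<x} s \<partial>lebesgue)"
      by (simp add: AE_completion_iff)
    then show "AE x in lborel. a * kint (t / 2) * indicator {t/2<..<t} x \<le>
        (\<integral>\<^sup>+s. k x s * U s \<partial>lebesgue) + ennreal \<tau> * ?IF * indicator {0<..<t} x"
    proof eventually_elim
      case (elim x)
      show ?case
      proof (cases "x \<in> {t/2<..<t}")
        case True
        have "a * kint (t / 2) \<le> a * kint x" using True by (intro mult_left_mono kint_mono) auto
        also have "\<dots> \<le> (\<integral>\<^sup>+s. ennreal (\<kappa> (x - s)) * indicator {0<..<x} s * U s \<partial>lebesgue) +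
            ennreal \<tau> * (\<integral>\<^sup>+s. F s * indicator {0<..<x} s \<partial>lebesgue)"
          using elim True t t0 by auto
        also have "\<dots> \<le> (\<integral>\<^sup>+s. k x s * U s \<partial>lebesgue) + ennreal \<tau> * ?IF"
          using True
          by (intro add_mono mult_left_mono nn_integral_mono) (auto simp: k_def split: split_indicator)
        finally show ?thesis using True t0 by simp
      qed simp
    qed
  qed
  also have "\<dots> = (\<integral>\<^sup>+s. (\<integral>\<^sup>+x. k x s \<partial>lborel) * U s \<partial>lebesgue) + ennreal \<tau> * ?IF * ennreal t"
    using lebesgue_Tonelli[OF U km] t0
    by (subst nn_integral_add) (auto simp: nn_integral_cmult_indicator)
  also have "(\<integral>\<^sup>+s. (\<integral>\<^sup>+x. k x s \<partial>lborel) * U s \<partial>lebesgue) \<le> (\<integral>\<^sup>+s. kint t * (U s * indicator {0<..<t} s) \<partial>lebesgue)"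
  proof (rule nn_integral_mono)
    fix s
    have "(\<integral>\<^sup>+x. k x s \<partial>lborel) \<le> kint t * indicator {0<..<t} s"
    proof (cases "s \<in> {0<..<t}")
      case True
      have "(\<integral>\<^sup>+x. k x s \<partial>lborel) = (\<integral>\<^sup>+x. ennreal (\<kappa> (x - s)) * indicator {s<..<t} x \<partial>lborel)"
        using True by (intro nn_integral_cong) (auto simp: k_def split: split_indicator)
      also have "\<dots> \<le> kint t" unfolding kint_translate using True by (intro kint_mono) auto
      finally show ?thesis using True by simp
    next
      case False
      then have "k x s = 0" for x by (auto simp: k_def split: split_indicator)
      then show ?thesis by simp
    qed
    then have "(\<integral>\<^sup>+x. k x s \<partial>lborel) * U s \<le> kint t * indicator {0<..<t} s * U s" by (rule mult_right_mono) simp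
    then show "(\<integral>\<^sup>+x. k x s \<partial>lborel) * U s \<le> kint t * (U s * indicator {0<..<t} s)"
      by (simp add: mult_ac)
  qed
  also have "\<dots> = kint t * ?IU" by (intro nn_integral_cmult) measurable
  also have "ennreal \<tau> * ?IF * ennreal t = ennreal (t * \<tau>) * ?IF"
    using t0 \<tau> by (simp add: ennreal_mult mult_ac)
  also have "\<dots> \<le> kint t * ?IF"
    using kint_ge_inverse[OF \<tau>] t by (intro mult_right_mono) auto
  also have "kint t * ?IU + kint t * ?IF = kint t * (\<integral>\<^sup>+s. (U s + F s) * indicator {0<..<t} s \<partial>lebesgue)"
    by (simp add: distrib_left[symmetric] distrib_right nn_integral_add)
  finally have "kint t * (ennreal (t / 4) * a) \<le> kint t * (\<integral>\<^sup>+s. (U s + F s) * indicator {0<..<t} s \<partial>lebesgue)"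
    by (simp add: mult_ac)
  moreover have "kint t \<noteq> 0"
  proof
    assume "kint t = 0"
    then have "t * \<kappa> t \<le> 0" using kint_ge[OF t0] by (simp add: ennreal_eq_0_iff)
    then show False using mult_pos_pos[OF t0 kappa_pos[OF t0]] by simp
  qed
  ultimately show ?thesis using kint_finite[of t] by (simp add: ennreal_mult_le_mult_iff)
qed

end

section \<open>A Hardy inequality for Muckenhoupt weights\<close>

lemma primitive_eq_nn_integral:
  assumes "w \<in> borel_measurable lebesgue" "\<And>x. 0 \<le> w x" "0 < primitive w r"
  shows "(\<integral>\<^sup>+s. ennreal (w s) * indicator {0..r} s \<partial>lebesgue) = ennreal (primitive w r)"
proof -
  have int: "integrable lebesgue (\<lambda>s. indicator {0..r} s *\<^sub>R w s)"
    using assms(3) not_integrable_integral_eq[of lebesgue "\<lambda>s. indicator {0..r} s *\<^sub>R w s"]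
    by (auto simp: primitive_def set_lebesgue_integral_def)
  have "(\<integral>\<^sup>+s. ennreal (indicator {0..r} s *\<^sub>R w s) \<partial>lebesgue) = ennreal (primitive w r)"
    unfolding primitive_def set_lebesgue_integral_def
    by (rule nn_integral_eq_integral[OF int]) (use assms in auto)
  also have "(\<integral>\<^sup>+s. ennreal (indicator {0..r} s *\<^sub>R w s) \<partial>lebesgue) = (\<integral>\<^sup>+s. ennreal (w s) * indicator {0..r} s \<partial>lebesgue)"
    by (intro nn_integral_cong) (auto split: split_indicator)
  finally show ?thesis .
qed

lemma primitive_mono:
  assumes w: "w \<in> borel_measurable lebesgue" "\<And>x. 0 \<le> w x"
    and b: "0 < primitive w b" and rs: "r \<le> s" "s \<le> b"
  shows "primitive w r \<le> primitive w s"
  unfolding primitive_def set_lebesgue_integral_def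
proof (rule integral_mono)
  have int: "set_integrable lebesgue {0..b} w"
    using b not_integrable_integral_eq[of lebesgue "\<lambda>s. indicator {0..b} s *\<^sub>R w s"]
    by (auto simp: primitive_def set_lebesgue_integral_def set_integrable_def)
  have "set_integrable lebesgue {0..r} w" "set_integrable lebesgue {0..s} w"
    by (rule set_integrable_subset[OF int]; use rs in auto)+
  then show "integrable lebesgue (\<lambda>x. indicator {0..r} x *\<^sub>R w x)" "integrable lebesgue (\<lambda>x. indicator {0..s} x *\<^sub>R w x)"
    by (auto simp: set_integrable_def)
qed (use rs w in \<open>auto split: split_indicator\<close>)

text \<open>
  The Muckenhoupt condition on \<open>[0, r]\<close>, solved for the integral of the dual weight.
\<close>

lemma Ap_dual_weight_bound:
  assumes w: "w \<in> borel_measurable lebesgue" "\<And>x. 0 \<le> w x"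
    and p: "1 < p" and A: "Ap_const p w \<le> ennreal A" "0 \<le> A" and r: "0 < r" "0 < primitive w r"
  shows "(\<integral>\<^sup>+s. ennreal (w s powr (- 1 / (p - 1))) * indicator {0..r} s \<partial>lebesgue)
    \<le> ennreal (r * (A * r / primitive w r) powr (1 / (p - 1)))" (is "?V \<le> _")
proof -
  define W where "W = primitive w r"
  have W: "0 < W" using r by (simp add: W_def)
  have "(ennreal (1 / (r - 0)) * (\<integral>\<^sup>+s. ennreal (w s) * indicator {0..r} s \<partial>lebesgue)) *
     epowr (ennreal (1 / (r - 0)) * ?V) (p - 1) \<le> Ap_const p w"
    unfolding Ap_const_def by (rule SUP_upper2[where i = "(0, r)"]) (use r in auto)
  then have le: "ennreal (W / r) * epowr (ennreal (1 / r) * ?V) (p - 1) \<le> ennreal A"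
    using A(1) r W by (simp add: primitive_eq_nn_integral[OF w r(2)] W_def divide_ennreal flip: ennreal_mult)
  show ?thesis
  proof (cases ?V)
    case top
    then show ?thesis
      using le r W by (simp add: epowr_def ennreal_mult_top ennreal_mult_eq_top_iff top_unique)
  next
    case (real x)
    have eq: "ennreal (1 / r) * ennreal x = ennreal (x / r)" using real(1) r by (simp flip: ennreal_mult)
    have "ennreal (W / r * (x / r) powr (p - 1)) \<le> ennreal A"
      using le real r W unfolding real(2) eq by (simp add: epowr_def flip: ennreal_mult)
    then have "W / r * (x / r) powr (p - 1) \<le> A" using A by (simp add: ennreal_le_iff)
    then have "(x / r) powr (p - 1) \<le> A * r / W" using W r by (simp add: field_simps)
    then have "((x / r) powr (p - 1)) powr (1 / (p - 1)) \<le> (A * r / W) powr (1 / (p - 1))"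
      using p by (intro powr_mono2) auto
    moreover have "((x / r) powr (p - 1)) powr (1 / (p - 1)) = x / r"
      using p real r by (simp add: powr_powr)
    ultimately have "x / r \<le> (A * r / W) powr (1 / (p - 1))" by simp
    then show ?thesis unfolding real(2) W_def[symmetric] using r by (intro ennreal_leI) (simp add: field_simps)
  qed
qed

text \<open>
  Layer cake: \<open>s powr - \<alpha>\<close> is \<open>t powr - \<alpha>\<close> plus the integral of \<open>\<alpha> * r powr (- \<alpha> - 1)\<close> over \<open>(s, t)\<close>.
  Exchanging the integrals leaves only the integrals of \<open>v\<close> over \<open>[0, r]\<close>.
\<close>

lemma dual_weight_power_integral:
  fixes v :: "real \<Rightarrow> real"
  assumes v: "v \<in> borel_measurable lebesgue" and "0 < \<alpha>" "0 < t" "0 \<le> B"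
    and V: "\<And>r. 0 < r \<Longrightarrow> r \<le> t \<Longrightarrow>
      (\<integral>\<^sup>+s. ennreal (v s) * indicator {0..r} s \<partial>lebesgue) \<le> ennreal (B * r powr (2 * \<alpha>))"
  shows "(\<integral>\<^sup>+s. ennreal (s powr - \<alpha>) * indicator {0<..<t} s * ennreal (v s) \<partial>lebesgue) \<le> ennreal (2 * B * t powr \<alpha>)"
proof -
  define k where "k r s = ennreal (\<alpha> * r powr (- \<alpha> - 1)) * indicator {0<..} (r - s) * indicator {..<t} r * indicator {0<..} s"
    for r s :: real
  have km: "(\<lambda>(r, s). k r s) \<in> borel_measurable (borel \<Otimes>\<^sub>M borel)"
    unfolding k_def by measurable
  have vm: "(\<lambda>s. ennreal (v s)) \<in> borel_measurable lebesgue" using v by measurable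
  have ind[measurable]: "indicator {0..t} \<in> borel_measurable lebesgue"
    by (rule borel_measurable_indicator) simp
  note [measurable] = vm
  note T = lebesgue_Tonelli[OF vm km]
  have split: "ennreal (s powr - \<alpha>) * indicator {0<..<t} s \<le> ennreal (t powr - \<alpha>) * indicator {0..t} s + (\<integral>\<^sup>+r. k r s \<partial>lborel)" for s
  proof (cases "s \<in> {0<..<t}")
    case True
    have "(\<integral>\<^sup>+r. k r s \<partial>lborel) = (\<integral>\<^sup>+r. ennreal (\<alpha> * r powr (- \<alpha> - 1)) * indicator {s<..<t} r \<partial>lborel)"
      using True by (intro nn_integral_cong) (auto simp: k_def split: split_indicator)
    also have "\<dots> = ennreal (s powr - \<alpha> - t powr - \<alpha>)"
      using True assms by (intro nn_integral_powr_neg) auto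
    finally have "(\<integral>\<^sup>+r. k r s \<partial>lborel) = ennreal (s powr - \<alpha> - t powr - \<alpha>)" .
    moreover have "t powr - \<alpha> \<le> s powr - \<alpha>" using True assms by (intro powr_mono2') auto
    ultimately show ?thesis using True by (simp flip: ennreal_plus)
  qed auto
  have "(\<integral>\<^sup>+s. ennreal (s powr - \<alpha>) * indicator {0<..<t} s * ennreal (v s) \<partial>lebesgue)
    \<le> (\<integral>\<^sup>+s. ennreal (t powr - \<alpha>) * (ennreal (v s) * indicator {0..t} s) + (\<integral>\<^sup>+r. k r s \<partial>lborel) * ennreal (v s) \<partial>lebesgue)"
  proof (rule nn_integral_mono)
    fix s
    show "ennreal (s powr - \<alpha>) * indicator {0<..<t} s * ennreal (v s) \<le>
      ennreal (t powr - \<alpha>) * (ennreal (v s) * indicator {0..t} s) + (\<integral>\<^sup>+r. k r s \<partial>lborel) * ennreal (v s)"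
      using mult_right_mono[OF split[of s], of "ennreal (v s)"] by (simp add: distrib_left distrib_right mult_ac)
  qed
  also have "\<dots> = ennreal (t powr - \<alpha>) * (\<integral>\<^sup>+s. ennreal (v s) * indicator {0..t} s \<partial>lebesgue)
      + (\<integral>\<^sup>+s. (\<integral>\<^sup>+r. k r s \<partial>lborel) * ennreal (v s) \<partial>lebesgue)"
  proof (subst nn_integral_add)
    have "(\<lambda>s. \<integral>\<^sup>+r. k r s \<partial>lborel) \<in> borel_measurable borel"
    proof (rule lborel.borel_measurable_nn_integral)
      show "(\<lambda>(s, r). k r s) \<in> borel_measurable (borel \<Otimes>\<^sub>M lborel)" unfolding k_def by measurable
    qed
    then have "(\<lambda>s. \<integral>\<^sup>+r. k r s \<partial>lborel) \<in> borel_measurable lebesgue"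
      by (intro measurable_completion) simp
    then show "(\<lambda>s. (\<integral>\<^sup>+r. k r s \<partial>lborel) * ennreal (v s)) \<in> borel_measurable lebesgue" by measurable
  qed (auto simp: nn_integral_cmult)
  also have "\<dots> \<le> ennreal (t powr - \<alpha>) * ennreal (B * t powr (2 * \<alpha>)) + ennreal (B * t powr \<alpha>)"
  proof (intro add_mono mult_left_mono V)
    have "(\<integral>\<^sup>+s. (\<integral>\<^sup>+r. k r s \<partial>lborel) * ennreal (v s) \<partial>lebesgue) = (\<integral>\<^sup>+r. (\<integral>\<^sup>+s. k r s * ennreal (v s) \<partial>lebesgue) \<partial>lborel)"
      by (simp add: T)
    also have "\<dots> \<le> (\<integral>\<^sup>+r. ennreal (\<alpha> * B) * (ennreal (r powr (\<alpha> - 1)) * indicator {0<..<t} r) \<partial>lborel)"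
    proof (rule nn_integral_mono)
      fix r
      show "(\<integral>\<^sup>+s. k r s * ennreal (v s) \<partial>lebesgue) \<le> ennreal (\<alpha> * B) * (ennreal (r powr (\<alpha> - 1)) * indicator {0<..<t} r)"
      proof (cases "r \<in> {0<..<t}")
        case True
        have [measurable]: "indicator {0..r} \<in> borel_measurable lebesgue"
          by (rule borel_measurable_indicator) simp
        have "(\<integral>\<^sup>+s. k r s * ennreal (v s) \<partial>lebesgue)
          \<le> (\<integral>\<^sup>+s. ennreal (\<alpha> * r powr (- \<alpha> - 1)) * (ennreal (v s) * indicator {0..r} s) \<partial>lebesgue)"
          by (intro nn_integral_mono) (auto simp: k_def split: split_indicator)
        also have "\<dots> = ennreal (\<alpha> * r powr (- \<alpha> - 1)) * (\<integral>\<^sup>+s. ennreal (v s) * indicator {0..r} s \<partial>lebesgue)"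
          by (rule nn_integral_cmult) measurable
        also have "\<dots> \<le> ennreal (\<alpha> * r powr (- \<alpha> - 1)) * ennreal (B * r powr (2 * \<alpha>))"
          using True by (intro mult_left_mono V) auto
        also have "\<dots> = ennreal (\<alpha> * B * (r powr (- \<alpha> - 1) * r powr (2 * \<alpha>)))"
          using assms by (simp add: mult_ac flip: ennreal_mult)
        also have "r powr (- \<alpha> - 1) * r powr (2 * \<alpha>) = r powr (\<alpha> - 1)"
          by (simp flip: powr_add)
        finally show ?thesis using True assms by (simp add: ennreal_mult)
      next
        case False
        then have "k r s = 0" for s by (auto simp: k_def split: split_indicator)
        then show ?thesis by simp
      qed
    qed
    also have "\<dots> = ennreal (\<alpha> * B) * ennreal (t powr \<alpha> / \<alpha>)"
    proof -
      have "(\<integral>\<^sup>+r. ennreal (r powr (\<alpha> - 1)) * indicator {0<..<t} r \<partial>lborel) = ennreal (t powr \<alpha> / \<alpha>)"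
        using assms by (intro nn_integral_powr_0) auto
      then show ?thesis by (subst nn_integral_cmult) auto
    qed
    also have "\<dots> = ennreal (B * t powr \<alpha>)" using assms by (simp flip: ennreal_mult)
    finally show "(\<integral>\<^sup>+s. (\<integral>\<^sup>+r. k r s \<partial>lborel) * ennreal (v s) \<partial>lebesgue) \<le> ennreal (B * t powr \<alpha>)" .
  qed (use assms in auto)
  also have "ennreal (t powr - \<alpha>) * ennreal (B * t powr (2 * \<alpha>)) = ennreal (B * (t powr - \<alpha> * t powr (2 * \<alpha>)))"
    using assms by (simp add: mult_ac flip: ennreal_mult)
  also have "t powr - \<alpha> * t powr (2 * \<alpha>) = t powr \<alpha>" by (simp flip: powr_add)
  also have "ennreal (B * t powr \<alpha>) + ennreal (B * t powr \<alpha>) = ennreal (2 * B * t powr \<alpha>)"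
    using assms by (simp flip: ennreal_plus)
  finally show ?thesis .
qed

text \<open>
  A Hardy inequality before integration in \<open>t\<close>.  Hoelder's inequality with the dual weight alone would
  give the right side without the factor \<open>(s / t) powr a\<close>, and the resulting bound could not be
  integrated against \<open>dt / t\<close>.  The decay in \<open>s / t\<close> is gained by moving a small power of \<open>s\<close> from one
  factor to the other.  The dual weight tolerates the singular power \<open>s powr - \<alpha>\<close> because \<open>W\<close> grows more
  slowly than \<open>t powr p\<close>: together with the Muckenhoupt condition the growth bound makes the integral of
  the dual weight over \<open>[0, r]\<close> at most a multiple of \<open>r powr (2 * \<alpha>)\<close>.
\<close>

lemma weighted_Hardy:
  fixes w h W :: "real \<Rightarrow> real"
  assumes p: "1 < p" and d: "0 \<le> d" "d < p" and A: "0 < A" and L: "0 < L" and t: "0 < t"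
    and w: "w \<in> borel_measurable lebesgue" "\<And>x. 0 \<le> w x" "AE x in lebesgue. 0 < w x"
    and h: "h \<in> borel_measurable lebesgue" "\<And>x. 0 \<le> h x"
    and Wpos: "\<And>r. 0 < r \<Longrightarrow> 0 < W r"
    and V: "\<And>r. 0 < r \<Longrightarrow> (\<integral>\<^sup>+s. ennreal (w s powr (- 1 / (p - 1))) * indicator {0..r} s \<partial>lebesgue)
      \<le> ennreal (r * (A * r / W r) powr (1 / (p - 1)))"
    and growth: "\<And>r. 0 < r \<Longrightarrow> r \<le> t \<Longrightarrow> W t \<le> L * (t / r) powr d * W r"
    and k: "0 \<le> k" "ennreal k \<le> (\<integral>\<^sup>+s. ennreal (h s) * indicator {0<..<t} s \<partial>lebesgue)"
  shows "ennreal (W t * (k / t) powr p) \<le> ennreal (2 powr (p - 1) * A * L) *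
    (\<integral>\<^sup>+s. ennreal ((s / t) powr ((p - d) / 2)) * indicator {0<..<t} s * ennreal (h s powr p * w s) \<partial>lebesgue)"
proof -
  define q where "q = p / (p - 1)"
  \<comment> \<open>any \<open>a\<close> strictly between \<open>0\<close> and \<open>p - d\<close> would do; with the midpoint the two contributions in
    \<open>dual_weight_power_integral\<close> are equal\<close>
  define a where "a = (p - d) / 2"
  define \<alpha> where "\<alpha> = a / (p - 1)"
  define B where "B = (A * L * t powr d / W t) powr (1 / (p - 1))"
  have "0 < a" using d by (simp add: a_def)
  then have \<alpha>: "0 < \<alpha>" "\<alpha> * (p - 1) = a" using p by (auto simp: \<alpha>_def)
  have Wt: "0 < W t" by (rule Wpos) fact
  have B: "0 < B" using A L t Wt by (simp add: B_def)
  let ?v = "\<lambda>s. w s powr (- 1 / (p - 1))"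
  have vm: "?v \<in> borel_measurable lebesgue" using w by measurable
  have V': "(\<integral>\<^sup>+s. ennreal (?v s) * indicator {0..r} s \<partial>lebesgue) \<le> ennreal (B * r powr (2 * \<alpha>))"
    if r: "0 < r" "r \<le> t" for r
  proof -
    have "1 / W r \<le> L * (t / r) powr d / W t"
      using growth[OF r] Wpos[OF r(1)] Wt by (simp add: field_simps)
    then have "A * r / W r \<le> A * r * (L * (t / r) powr d / W t)"
      using mult_left_mono[of "1 / W r" "L * (t / r) powr d / W t" "A * r"] A r by simp
    also have "\<dots> = (A * L * t powr d / W t) * r powr (1 - d)"
      using r t by (simp add: powr_divide powr_diff mult_ac)
    finally have "(A * r / W r) powr (1 / (p - 1)) \<le> ((A * L * t powr d / W t) * r powr (1 - d)) powr (1 / (p - 1))"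
      using p A r Wpos[OF r(1)] by (intro powr_mono2) (auto simp: less_imp_le)
    also have "\<dots> = B * r powr ((1 - d) / (p - 1))"
      using A L Wt unfolding B_def by (subst powr_mult) (simp_all add: powr_powr)
    finally have "r * (A * r / W r) powr (1 / (p - 1)) \<le> r * (B * r powr ((1 - d) / (p - 1)))"
      using r by (intro mult_left_mono) auto
    also have "\<dots> = B * r powr (1 + (1 - d) / (p - 1))" using r by (simp add: powr_add)
    also have "1 + (1 - d) / (p - 1) = 2 * \<alpha>" using p by (simp add: \<alpha>_def a_def field_simps)
    finally show ?thesis using V[OF r(1)] by (meson ennreal_leI order_trans)
  qed
  define b where "b = 2 * B * t powr \<alpha>"
  have b: "0 < b" using B t by (simp add: b_def)
  \<comment> \<open>\<open>f\<close> and \<open>g\<close> multiply to \<open>h\<close> on \<open>(0, t)\<close> wherever the weight is positive\<close>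
  define f where "f s = h s * w s powr (1 / p) * s powr (\<alpha> / q) * indicator {0<..<t} s" for s
  define g where "g s = w s powr (- 1 / p) * s powr (- \<alpha> / q) * indicator {0<..<t} s" for s
  have idm[measurable]: "(\<lambda>x. x) \<in> borel_measurable lebesgue" by (rule measurable_completion) simp
  have [measurable]: "indicator {0<..<t} \<in> borel_measurable lebesgue"
    by (rule borel_measurable_indicator) simp
  note [measurable] = w(1) h(1)
  have fm: "f \<in> borel_measurable lebesgue" and gm: "g \<in> borel_measurable lebesgue"
    unfolding f_def g_def by measurable
  have fp: "f s powr p = s powr a * indicator {0<..<t} s * (h s powr p * w s)" for s
    using p w(2)[of s] h(2)[of s] \<alpha>
    by (auto simp: f_def q_def powr_mult powr_powr split: split_indicator)
  have gq: "g s powr q = s powr - \<alpha> * indicator {0<..<t} s * ?v s" for s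
    using p by (auto simp: g_def q_def powr_mult powr_powr split: split_indicator)
  have "ennreal (k powr p / b powr (p - 1)) \<le> (\<integral>\<^sup>+s. f s powr p \<partial>lebesgue)"
  proof (rule Holder_lower_bound[OF fm gm _ _ p q_def b k(1)])
    show "0 \<le> f s" "0 \<le> g s" for s using h(2) by (auto simp: f_def g_def)
    have "(\<integral>\<^sup>+s. ennreal (h s) * indicator {0<..<t} s \<partial>lebesgue) = (\<integral>\<^sup>+s. f s * g s \<partial>lebesgue)"
    proof (rule nn_integral_cong_AE)
      show "AE s in lebesgue. ennreal (h s) * indicator {0<..<t} s = ennreal (f s * g s)"
        using w(3)
      proof eventually_elim
        case (elim s)
        show ?case
        proof (cases "s \<in> {0<..<t}")
          case True
          have *: "w s powr (1 / p) * w s powr (- 1 / p) = 1" "s powr (\<alpha> / q) * s powr (- \<alpha> / q) = 1"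
            using elim True by (auto simp flip: powr_add)
          have "f s * g s = h s * (w s powr (1 / p) * w s powr (- 1 / p)) * (s powr (\<alpha> / q) * s powr (- \<alpha> / q))"
            unfolding f_def g_def using True by (simp only: mult_ac indicator_simps mult_1_left mult_1_right)
          then show ?thesis unfolding * using True by simp
        qed (simp add: f_def)
      qed
    qed
    then show "ennreal k \<le> (\<integral>\<^sup>+s. ennreal (f s * g s) \<partial>lebesgue)" using k by simp
    have "(\<integral>\<^sup>+s. ennreal (s powr - \<alpha>) * indicator {0<..<t} s * ennreal (?v s) \<partial>lebesgue) \<le> ennreal b"
      unfolding b_def using B by (intro dual_weight_power_integral[OF vm \<alpha>(1) t _ V']) auto
    also have "(\<integral>\<^sup>+s. ennreal (s powr - \<alpha>) * indicator {0<..<t} s * ennreal (?v s) \<partial>lebesgue) = (\<integral>\<^sup>+s. g s powr q \<partial>lebesgue)"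
      by (intro nn_integral_cong) (auto simp: gq ennreal_mult split: split_indicator)
    finally show "(\<integral>\<^sup>+s. ennreal (g s powr q) \<partial>lebesgue) \<le> ennreal b" .
  qed
  also have "(\<integral>\<^sup>+s. f s powr p \<partial>lebesgue) =
      (\<integral>\<^sup>+s. ennreal (t powr a) * (ennreal ((s / t) powr a) * indicator {0<..<t} s * ennreal (h s powr p * w s)) \<partial>lebesgue)"
  proof (rule nn_integral_cong)
    fix s
    have "s powr a = t powr a * (s / t) powr a" if "0 < s" using that t by (simp add: powr_divide)
    then show "ennreal (f s powr p) = ennreal (t powr a) * (ennreal ((s / t) powr a) * indicator {0<..<t} s * ennreal (h s powr p * w s))"
      unfolding fp using w(2)[of s] by (auto simp: mult_ac split: split_indicator simp flip: ennreal_mult)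
  qed
  also have "\<dots> = ennreal (t powr a) * (\<integral>\<^sup>+s. ennreal ((s / t) powr a) * indicator {0<..<t} s * ennreal (h s powr p * w s) \<partial>lebesgue)"
    (is "_ = _ * ?I") by (rule nn_integral_cmult) measurable
  finally have main: "ennreal (k powr p / b powr (p - 1)) \<le> ennreal (t powr a) * ?I" .
  have bp: "b powr (p - 1) = 2 powr (p - 1) * (A * L * t powr d / W t) * t powr a"
  proof -
    have "B powr (p - 1) = A * L * t powr d / W t"
      using p A L t Wt by (simp add: B_def powr_powr)
    moreover have "(t powr \<alpha>) powr (p - 1) = t powr a" by (simp add: powr_powr \<alpha>)
    ultimately show ?thesis using B t by (simp add: b_def powr_mult)
  qed
  have tp: "t powr p = t powr d * t powr a * t powr a"
    by (simp add: a_def flip: powr_add)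
  have "W t * (k / t) powr p = 2 powr (p - 1) * A * L * inverse (t powr a) * (k powr p / b powr (p - 1))"
    unfolding bp powr_divide tp
    using A L t Wt by (simp add: field_simps)
  then have "ennreal (W t * (k / t) powr p) = ennreal (2 powr (p - 1) * A * L * inverse (t powr a)) * ennreal (k powr p / b powr (p - 1))"
    using A L by (simp flip: ennreal_mult)
  also have "\<dots> \<le> ennreal (2 powr (p - 1) * A * L * inverse (t powr a)) * (ennreal (t powr a) * ?I)"
    by (intro mult_left_mono main) simp
  also have "\<dots> = ennreal (2 powr (p - 1) * A * L * inverse (t powr a) * t powr a) * ?I"
    using A L by (simp add: ennreal_mult mult.assoc)
  also have "2 powr (p - 1) * A * L * inverse (t powr a) * t powr a = 2 powr (p - 1) * A * L"
    using t by simp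
  finally show ?thesis by (simp add: a_def)
qed

section \<open>Integrating the Hardy inequality\<close>

context convolution_kernel
begin

lemma kstar_inverse: "kstar \<kappa> (1 / \<tau>) = gen_inverse \<kappa> \<tau>"
  by (simp add: kstar_def)

lemma gen_inverse_antimono:
  assumes "0 < \<sigma>" "\<sigma> \<le> \<tau>" shows "gen_inverse \<kappa> \<tau> \<le> gen_inverse \<kappa> \<sigma>"
proof -
  have \<tau>: "0 < \<tau>" using assms by simp
  let ?s = "gen_inverse \<kappa> \<sigma>"
  have s: "0 < ?s" using gen_inverse_pos assms by simp
  have "\<kappa> ?s \<le> \<sigma>" using gen_inverse_le_iff[OF assms(1) s] by simp
  then show ?thesis using gen_inverse_le_iff[OF \<tau> s] assms by simp
qed

lemma kstar_mono:
  assumes "0 < x" "x \<le> y" shows "kstar \<kappa> x \<le> kstar \<kappa> y"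
  unfolding kstar_def using assms by (intro gen_inverse_antimono) (auto simp: frac_le)

lemma kstar_above:
  assumes "0 < t" shows "t \<le> kstar \<kappa> (2 / \<kappa> t)"
proof -
  have "0 < \<kappa> t" by (rule kappa_pos) fact
  then have "\<not> gen_inverse \<kappa> (\<kappa> t / 2) \<le> t"
    by (subst gen_inverse_le_iff) (use assms in auto)
  then show ?thesis by (simp add: kstar_def)
qed

lemma kstar_below:
  assumes "0 < t" shows "kstar \<kappa> (1 / \<kappa> t) \<le> t"
  using gen_inverse_le_iff[of "\<kappa> t" t] kappa_pos[OF assms] assms by (simp add: kstar_def)

text \<open>
  If \<open>\<kappa>\<close> is constant to the left of \<open>t\<close>, then \<open>kstar \<kappa> (1 / \<kappa> t)\<close> is smaller than \<open>t\<close>.  The factor \<open>2\<close> in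
  the last bound moves past such an interval.
\<close>

lemma primitive_kstar_bounds:
  assumes w: "w \<in> borel_measurable lebesgue" "\<And>x. 0 \<le> w x"
    and \<Phi>: "\<And>x. 0 < x \<Longrightarrow> 0 < primitive w (kstar \<kappa> x)" and t: "0 < t"
  shows "primitive w (kstar \<kappa> (1 / \<kappa> t)) \<le> primitive w t" "0 < primitive w t"
    "primitive w t \<le> primitive w (kstar \<kappa> (2 / \<kappa> t))"
proof -
  have k: "0 < \<kappa> t" by (rule kappa_pos) fact
  have mono: "primitive w r \<le> primitive w s" if "r \<le> s" "s \<le> kstar \<kappa> (2 / \<kappa> t)" for r s
    by (rule primitive_mono[OF w \<Phi>[of "2 / \<kappa> t"] that]) (use k in auto)
  show 1: "primitive w (kstar \<kappa> (1 / \<kappa> t)) \<le> primitive w t"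
    by (intro mono kstar_below kstar_above t)
  show "0 < primitive w t" using 1 \<Phi>[of "1 / \<kappa> t"] k by simp
  show "primitive w t \<le> primitive w (kstar \<kappa> (2 / \<kappa> t))"
    by (intro mono kstar_above t) simp
qed

text \<open>
  The hypothesis on \<open>W \<circ> kstar \<kappa>\<close> bounds the growth of \<open>W\<close> in terms of \<open>1 / \<kappa>\<close>, which in turn grows at
  most linearly.  Hence \<open>W\<close> itself grows like a power with exponent less than \<open>p\<close>.
\<close>

lemma primitive_growth:
  assumes w: "w \<in> borel_measurable lebesgue" "\<And>x. 0 \<le> w x"
    and \<Phi>: "\<And>x. 0 < x \<Longrightarrow> 0 < primitive w (kstar \<kappa> x)"
    and \<Phi>g: "\<And>x y. 0 < x \<Longrightarrow> x \<le> y \<Longrightarrow> primitive w (kstar \<kappa> y) \<le> L * (y / x) powr d * primitive w (kstar \<kappa> x)"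
    and L: "0 \<le> L" and d: "0 \<le> d"
    and M: "1 \<le> M" and \<kappa>g: "\<And>r t. 0 < r \<Longrightarrow> r \<le> t \<Longrightarrow> \<kappa> r \<le> M * (t / r) * \<kappa> t"
    and rt: "0 < r" "r \<le> t"
  shows "primitive w t \<le> L * (2 * M) powr d * (t / r) powr d * primitive w r"
proof -
  have t: "0 < t" using rt by simp
  have k: "0 < \<kappa> t" "0 < \<kappa> r" using kappa_pos rt t by auto
  have "\<kappa> t \<le> \<kappa> r" using rt by (rule kappa_antimono)
  have "primitive w t \<le> primitive w (kstar \<kappa> (2 / \<kappa> t))" by (rule primitive_kstar_bounds(3)[OF w \<Phi> t])
  also have "\<dots> \<le> L * ((2 / \<kappa> t) / (1 / \<kappa> r)) powr d * primitive w (kstar \<kappa> (1 / \<kappa> r))"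
    by (rule \<Phi>g) (use k \<open>\<kappa> t \<le> \<kappa> r\<close> in \<open>auto simp: field_simps\<close>)
  also have "\<dots> \<le> L * (2 * M * (t / r)) powr d * primitive w r"
  proof (intro mult_mono mult_left_mono powr_mono2)
    have "\<kappa> r / \<kappa> t \<le> M * (t / r)"
      using \<kappa>g[OF rt] k by (simp add: pos_divide_le_eq)
    then show "2 / \<kappa> t / (1 / \<kappa> r) \<le> 2 * M * (t / r)" by simp
    show "primitive w (kstar \<kappa> (1 / \<kappa> r)) \<le> primitive w r" by (rule primitive_kstar_bounds(1)[OF w \<Phi> rt(1)])
    show "0 \<le> primitive w (kstar \<kappa> (1 / \<kappa> r))" using \<Phi>[of "1 / \<kappa> r"] k by simp
  qed (use k L d M in auto)
  also have "(2 * M * (t / r)) powr d = (2 * M) powr d * (t / r) powr d"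
    using M rt by (intro powr_mult)
  finally show ?thesis by (simp add: mult.assoc)
qed

lemma kappa_power_kernel_measurable:
  "(\<lambda>(\<tau>, s). ennreal ((M * \<tau> / \<kappa> s) powr a / \<tau>) * indicator {0<..} s * indicator {0<..} \<tau> * indicator {0<..} (\<kappa> s - \<tau>))
    \<in> borel_measurable (borel \<Otimes>\<^sub>M borel)"
proof -
  \<comment> \<open>extended by \<open>0\<close> the kernel is Borel on the whole line, and the indicators hide the change\<close>
  define k where "k s = indicator {0<..} s * \<kappa> s" for s
  have [measurable]: "k \<in> borel_measurable borel" unfolding k_def by (rule kappa_measurable)
  have "(\<lambda>(\<tau>, s). ennreal ((M * \<tau> / k s) powr a / \<tau>) * indicator {0<..} s * indicator {0<..} \<tau> * indicator {0<..} (k s - \<tau>))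
    \<in> borel_measurable (borel \<Otimes>\<^sub>M borel)" by measurable
  also have "(\<lambda>(\<tau>, s). ennreal ((M * \<tau> / k s) powr a / \<tau>) * indicator {0<..} s * indicator {0<..} \<tau> * indicator {0<..} (k s - \<tau>))
     = (\<lambda>(\<tau>, s). ennreal ((M * \<tau> / \<kappa> s) powr a / \<tau>) * indicator {0<..} s * indicator {0<..} \<tau> * indicator {0<..} (\<kappa> s - \<tau>))"
    by (auto simp: fun_eq_iff k_def split: split_indicator)
  finally show ?thesis .
qed

text \<open>
  Here \<open>Kf \<tau>\<close> stands for the K-functional of the initial value.  For \<open>\<tau> \<ge> \<kappa> T\<close> the averages over
  \<open>(0, gen_inverse \<kappa> \<tau>)\<close> stay inside the time interval, and the Hardy inequality applies.  A point \<open>s\<close> lies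
  in \<open>(0, gen_inverse \<kappa> \<tau>)\<close> exactly if \<open>\<tau> < \<kappa> s\<close>, and there \<open>s / gen_inverse \<kappa> \<tau>\<close> is at most
  \<open>M * \<tau> / \<kappa> s\<close>; therefore the integral in \<open>d\<tau> / \<tau>\<close> for fixed \<open>s\<close> is that of a power of \<open>\<tau>\<close> over
  \<open>(0, \<kappa> s)\<close> and is bounded independently of \<open>s\<close>.  For \<open>\<tau> < \<kappa> T\<close> the function \<open>Kf\<close> is
  controlled by \<open>\<tau> * Kf (\<kappa> T)\<close>, while the growth bound on \<open>W \<circ> kstar \<kappa>\<close> keeps the integral at
  \<open>\<tau> = 0\<close> convergent since \<open>d < p\<close>.
\<close>

lemma weighted_interpolation_integral:
  fixes w h Kf :: "real \<Rightarrow> real"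
  assumes p: "1 < p" and T: "0 < T"
    and w: "w \<in> borel_measurable lebesgue" "\<And>x. 0 \<le> w x" "AE x in lebesgue. 0 < w x"
    and A: "Ap_const p w \<le> ennreal A" "0 < A"
    and h: "h \<in> borel_measurable lebesgue" "\<And>x. 0 \<le> h x"
    and \<Phi>: "\<And>x. 0 < x \<Longrightarrow> 0 < primitive w (kstar \<kappa> x)"
    and \<Phi>g: "\<And>x y. 0 < x \<Longrightarrow> x \<le> y \<Longrightarrow> primitive w (kstar \<kappa> y) \<le> L * (y / x) powr d * primitive w (kstar \<kappa> x)"
    and L: "0 < L" and d: "0 \<le> d" "d < p"
    and M: "1 \<le> M" and \<kappa>g: "\<And>r t. 0 < r \<Longrightarrow> r \<le> t \<Longrightarrow> \<kappa> r \<le> M * (t / r) * \<kappa> t"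
    and K0: "\<And>\<tau>. 0 < \<tau> \<Longrightarrow> 0 \<le> Kf \<tau>"
    and Kh: "\<And>\<tau>. 0 < \<tau> \<Longrightarrow> gen_inverse \<kappa> \<tau> \<le> T \<Longrightarrow>
      ennreal (gen_inverse \<kappa> \<tau> / 4 * Kf \<tau>) \<le> (\<integral>\<^sup>+s. ennreal (h s) * indicator {0<..<gen_inverse \<kappa> \<tau>} s \<partial>lebesgue)"
    and D: "0 < D" and KD: "\<And>\<tau>. 0 < \<tau> \<Longrightarrow> Kf \<tau> \<le> \<tau> * D * Kf (\<kappa> T)"
    and a_def: "a = (p - d) / 2"
    and C1_def: "C1 = 4 powr p * (2 powr (p - 1) * A * (L * (2 * M) powr d))"
  shows "(\<integral>\<^sup>+\<tau>\<in>{0<..}. ennreal (primitive w (kstar \<kappa> (1 / \<tau>)) * Kf \<tau> powr p / \<tau>) \<partial>lebesgue)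
    \<le> ennreal (C1 * (M powr a / a + L * D powr p * \<kappa> T powr p / (p - d))) *
        (\<integral>\<^sup>+s. ennreal (h s powr p * w s) * indicator {0<..<T} s \<partial>lebesgue)"
proof -
  define W where "W = primitive w"
  define G where "G = gen_inverse \<kappa>"
  define \<tau>0 where "\<tau>0 = \<kappa> T"
  define H where "H s = ennreal (h s powr p * w s) * indicator {0<..<T} s" for s
  define I where "I = (\<integral>\<^sup>+s. H s \<partial>lebesgue)"
  have \<tau>0: "0 < \<tau>0" using kappa_pos T by (simp add: \<tau>0_def)
  have a: "0 < a" using d by (simp add: a_def)
  have C1: "0 < C1" using A L M by (simp add: C1_def)
  have [measurable]: "indicator {0<..<T} \<in> borel_measurable lebesgue"
    by (rule borel_measurable_indicator) simp
  have Hm[measurable]: "H \<in> borel_measurable lebesgue"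
    using h w unfolding H_def by measurable
  have Wpos: "0 < W r" if "0 < r" for r
    unfolding W_def by (rule primitive_kstar_bounds(2)[OF w(1,2) \<Phi> that])
  \<comment> \<open>the factor \<open>4 powr p\<close> in \<open>C1\<close> undoes the \<open>1 / 4\<close> in the averaged bound on \<open>Kf\<close>\<close>
  have hardy: "ennreal (W (G \<tau>) * Kf \<tau> powr p) \<le> ennreal C1 *
      (\<integral>\<^sup>+s. ennreal ((s / G \<tau>) powr a) * indicator {0<..<G \<tau>} s * H s \<partial>lebesgue)"
    if \<tau>: "\<tau>0 \<le> \<tau>" for \<tau>
  proof -
    have \<tau>p: "0 < \<tau>" using \<tau> \<tau>0 by simp
    have G: "0 < G \<tau>" "G \<tau> \<le> T"
      using gen_inverse_pos[OF \<tau>p] gen_inverse_le_iff[OF \<tau>p T] \<tau> by (auto simp: G_def \<tau>0_def)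
    let ?k = "G \<tau> / 4 * Kf \<tau>"
    have "ennreal (W (G \<tau>) * (?k / G \<tau>) powr p) \<le> ennreal (2 powr (p - 1) * A * (L * (2 * M) powr d)) *
      (\<integral>\<^sup>+s. ennreal ((s / G \<tau>) powr ((p - d) / 2)) * indicator {0<..<G \<tau>} s * ennreal (h s powr p * w s) \<partial>lebesgue)"
    proof (rule weighted_Hardy[OF p d A(2) _ G(1) w h Wpos])
      show "0 < L * (2 * M) powr d" using L M by simp
      show "(\<integral>\<^sup>+s\<in>{0..r}. ennreal (w s powr (- 1 / (p - 1))) \<partial>lebesgue) \<le> ennreal (r * (A * r / W r) powr (1 / (p - 1)))"
        if "0 < r" for r
        unfolding W_def using Ap_dual_weight_bound[OF w(1,2) p A(1) _ that] A Wpos[OF that] by (simp add: W_def)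
      show "W (G \<tau>) \<le> L * (2 * M) powr d * (G \<tau> / r) powr d * W r" if "0 < r" "r \<le> G \<tau>" for r
        unfolding W_def by (rule primitive_growth[OF w(1,2) \<Phi> \<Phi>g _ d(1) M \<kappa>g that]) (use L in auto)
      show "0 \<le> ?k" using G K0[OF \<tau>p] by simp
      show "ennreal ?k \<le> (\<integral>\<^sup>+s\<in>{0<..<G \<tau>}. ennreal (h s) \<partial>lebesgue)"
        using Kh[OF \<tau>p] G(2) by (simp add: G_def)
    qed
    then have "ennreal (4 powr p) * ennreal (W (G \<tau>) * (?k / G \<tau>) powr p) \<le>
      ennreal (4 powr p) * (ennreal (2 powr (p - 1) * A * (L * (2 * M) powr d)) *
      (\<integral>\<^sup>+s. ennreal ((s / G \<tau>) powr ((p - d) / 2)) * indicator {0<..<G \<tau>} s * ennreal (h s powr p * w s) \<partial>lebesgue))"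
      by (intro mult_left_mono) auto
    also have "(\<integral>\<^sup>+s. ennreal ((s / G \<tau>) powr ((p - d) / 2)) * indicator {0<..<G \<tau>} s * ennreal (h s powr p * w s) \<partial>lebesgue)
      = (\<integral>\<^sup>+s. ennreal ((s / G \<tau>) powr a) * indicator {0<..<G \<tau>} s * H s \<partial>lebesgue)"
      using G by (intro nn_integral_cong) (auto simp: H_def a_def split: split_indicator)
    also have "ennreal (4 powr p) * (ennreal (2 powr (p - 1) * A * (L * (2 * M) powr d)) * (\<integral>\<^sup>+s. ennreal ((s / G \<tau>) powr a) * indicator {0<..<G \<tau>} s * H s \<partial>lebesgue))
      = ennreal C1 * (\<integral>\<^sup>+s. ennreal ((s / G \<tau>) powr a) * indicator {0<..<G \<tau>} s * H s \<partial>lebesgue)"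
      using A L M by (simp add: C1_def ennreal_mult mult.assoc)
    also have "ennreal (4 powr p) * ennreal (W (G \<tau>) * (?k / G \<tau>) powr p) = ennreal (W (G \<tau>) * Kf \<tau> powr p)"
    proof -
      have kG: "?k / G \<tau> = Kf \<tau> / 4" using G by simp
      have "4 powr p * (W (G \<tau>) * (?k / G \<tau>) powr p) = W (G \<tau>) * Kf \<tau> powr p"
        unfolding kG by (simp add: powr_divide)
      then show ?thesis using Wpos[OF G(1)] by (simp flip: ennreal_mult)
    qed
    finally show ?thesis .
  qed
  define k where "k \<tau> s = ennreal ((M * \<tau> / \<kappa> s) powr a / \<tau>) * indicator {0<..} s * indicator {0<..} \<tau> * indicator {0<..} (\<kappa> s - \<tau>)"
    for \<tau> s
  have km: "(\<lambda>(\<tau>, s). k \<tau> s) \<in> borel_measurable (borel \<Otimes>\<^sub>M borel)"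
    unfolding k_def by (rule kappa_power_kernel_measurable)
  note Tn = lebesgue_Tonelli[OF Hm km]
  \<comment> \<open>the domain \<open>s < G \<tau>\<close> is rewritten as \<open>\<tau> < \<kappa> s\<close>, which is jointly Borel in \<open>(\<tau>, s)\<close>\<close>
  have large: "ennreal (W (G \<tau>) * Kf \<tau> powr p / \<tau>) \<le> ennreal C1 * (\<integral>\<^sup>+s. k \<tau> s * H s \<partial>lebesgue)"
    if \<tau>: "\<tau>0 \<le> \<tau>" for \<tau>
  proof -
    have \<tau>p: "0 < \<tau>" using \<tau> \<tau>0 by simp
    have G: "0 < G \<tau>" using gen_inverse_pos[OF \<tau>p] by (auto simp: G_def)
    have kG: "\<kappa> (G \<tau>) \<le> \<tau>" using gen_inverse_le_iff[OF \<tau>p G] by (simp add: G_def)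
    have ptw: "ennreal (1 / \<tau>) * (ennreal ((s / G \<tau>) powr a) * indicator {0<..<G \<tau>} s) \<le> k \<tau> s" for s
    proof (cases "s \<in> {0<..<G \<tau>}")
      case True
      then have s: "0 < s" "s < G \<tau>" by auto
      have gt: "\<tau> < \<kappa> s" using gen_inverse_le_iff[OF \<tau>p s(1)] s by (simp add: G_def)
      have "\<kappa> s \<le> M * (G \<tau> / s) * \<kappa> (G \<tau>)" using s by (intro \<kappa>g) auto
      also have "\<dots> \<le> M * (G \<tau> / s) * \<tau>" using kG M s by (intro mult_left_mono) auto
      finally have "s / G \<tau> \<le> M * \<tau> / \<kappa> s" using s G kappa_pos[OF s(1)] by (simp add: field_simps)
      then have "(s / G \<tau>) powr a \<le> (M * \<tau> / \<kappa> s) powr a" using s G a by (intro powr_mono2) auto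
      then have "1 / \<tau> * (s / G \<tau>) powr a \<le> (M * \<tau> / \<kappa> s) powr a / \<tau>" using \<tau>p by (simp add: divide_right_mono)
      then show ?thesis using True gt \<tau>p by (simp add: k_def ennreal_leI flip: ennreal_mult)
    qed simp
    have "ennreal (W (G \<tau>) * Kf \<tau> powr p / \<tau>) = ennreal (1 / \<tau>) * ennreal (W (G \<tau>) * Kf \<tau> powr p)"
      using \<tau>p Wpos[OF G] by (simp flip: ennreal_mult)
    also have "\<dots> \<le> ennreal (1 / \<tau>) * (ennreal C1 * (\<integral>\<^sup>+s. ennreal ((s / G \<tau>) powr a) * indicator {0<..<G \<tau>} s * H s \<partial>lebesgue))"
      by (intro mult_left_mono hardy \<tau>) simp
    also have "\<dots> = ennreal C1 * (\<integral>\<^sup>+s. ennreal (1 / \<tau>) * (ennreal ((s / G \<tau>) powr a) * indicator {0<..<G \<tau>} s * H s) \<partial>lebesgue)"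
    proof (subst nn_integral_cmult)
      have [measurable]: "(\<lambda>x. x) \<in> borel_measurable lebesgue" by (rule measurable_completion) simp
      have [measurable]: "indicator {0<..<G \<tau>} \<in> borel_measurable lebesgue"
        by (rule borel_measurable_indicator) simp
      show "(\<lambda>s. ennreal ((s / G \<tau>) powr a) * indicator {0<..<G \<tau>} s * H s) \<in> borel_measurable lebesgue" by measurable
    qed (simp add: mult_ac)
    also have "\<dots> \<le> ennreal C1 * (\<integral>\<^sup>+s. k \<tau> s * H s \<partial>lebesgue)"
    proof (intro mult_left_mono nn_integral_mono)
      fix s show "ennreal (1 / \<tau>) * (ennreal ((s / G \<tau>) powr a) * indicator {0<..<G \<tau>} s * H s) \<le> k \<tau> s * H s"
        using mult_right_mono[OF ptw[of s], of "H s"] by (simp add: mult.assoc)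
    qed simp
    finally show ?thesis .
  qed
  define c where "c = L * D powr p * \<tau>0 powr d"
  have c: "0 < c" using L D \<tau>0 by (simp add: c_def)
  \<comment> \<open>the Hardy inequality at the threshold \<open>\<tau>0\<close> also controls the range below it\<close>
  have base: "ennreal (W (G \<tau>0) * Kf \<tau>0 powr p) \<le> ennreal C1 * I"
  proof -
    have "(\<integral>\<^sup>+s. ennreal ((s / G \<tau>0) powr a) * indicator {0<..<G \<tau>0} s * H s \<partial>lebesgue) \<le> I"
      unfolding I_def
    proof (rule nn_integral_mono)
      fix s
      have "(s / G \<tau>0) powr a \<le> 1" if "0 < s" "s < G \<tau>0"
        using that a by (intro powr_le1) auto
      then have "ennreal ((s / G \<tau>0) powr a) * indicator {0<..<G \<tau>0} s \<le> 1" by (auto split: split_indicator simp: ennreal_le_1)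
      then show "ennreal ((s / G \<tau>0) powr a) * indicator {0<..<G \<tau>0} s * H s \<le> H s"
        using mult_right_mono[of _ 1 "H s"] by fastforce
    qed
    then show ?thesis using hardy[of \<tau>0] by (meson mult_left_mono order_refl order_trans zero_le)
  qed
  have small: "ennreal (W (G \<tau>) * Kf \<tau> powr p / \<tau>) \<le> ennreal c * (ennreal C1 * I) * ennreal (\<tau> powr (p - d - 1))"
    if \<tau>: "0 < \<tau>" "\<tau> < \<tau>0" for \<tau>
  proof -
    have "primitive w (kstar \<kappa> (1 / \<tau>)) \<le> L * ((1 / \<tau>) / (1 / \<tau>0)) powr d * primitive w (kstar \<kappa> (1 / \<tau>0))"
      by (rule \<Phi>g) (use \<tau> \<tau>0 in \<open>auto simp: frac_le\<close>)
    then have 1: "W (G \<tau>) \<le> L * (\<tau>0 / \<tau>) powr d * W (G \<tau>0)" by (simp add: W_def G_def kstar_inverse)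
    have 2: "Kf \<tau> powr p \<le> (\<tau> * D * Kf \<tau>0) powr p"
      using KD[OF \<tau>(1)] K0[OF \<tau>(1)] p by (intro powr_mono2) (auto simp: \<tau>0_def)
    have G0: "0 < W (G \<tau>0)" using gen_inverse_pos[OF \<tau>0] by (intro Wpos) (simp add: G_def)
    have "W (G \<tau>) * Kf \<tau> powr p / \<tau> \<le> (L * (\<tau>0 / \<tau>) powr d * W (G \<tau>0)) * (\<tau> * D * Kf \<tau>0) powr p / \<tau>"
      using 1 2 \<tau> L G0 by (intro divide_right_mono mult_mono) auto
    also have "\<dots> = c * (W (G \<tau>0) * Kf \<tau>0 powr p) * \<tau> powr (p - d - 1)"
      using \<tau> \<tau>0 D K0[OF \<tau>0] by (simp add: c_def powr_mult powr_divide powr_diff)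
    finally have "ennreal (W (G \<tau>) * Kf \<tau> powr p / \<tau>) \<le> ennreal (c * (W (G \<tau>0) * Kf \<tau>0 powr p) * \<tau> powr (p - d - 1))"
      by (rule ennreal_leI)
    also have "\<dots> = ennreal c * ennreal (W (G \<tau>0) * Kf \<tau>0 powr p) * ennreal (\<tau> powr (p - d - 1))"
      using c G0 by (simp add: ennreal_mult)
    also have "\<dots> \<le> ennreal c * (ennreal C1 * I) * ennreal (\<tau> powr (p - d - 1))"
      by (intro mult_right_mono mult_left_mono base) auto
    finally show ?thesis .
  qed
  have "(\<integral>\<^sup>+\<tau>\<in>{0<..}. ennreal (primitive w (kstar \<kappa> (1 / \<tau>)) * Kf \<tau> powr p / \<tau>) \<partial>lebesgue)
    \<le> (\<integral>\<^sup>+\<tau>. ennreal C1 * (\<integral>\<^sup>+s. k \<tau> s * H s \<partial>lebesgue) +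
        ennreal c * (ennreal C1 * I) * (ennreal (\<tau> powr (p - d - 1)) * indicator {0<..<\<tau>0} \<tau>) \<partial>lborel)"
  proof (subst nn_integral_completion, rule nn_integral_mono)
    fix \<tau>
    show "ennreal (primitive w (kstar \<kappa> (1 / \<tau>)) * Kf \<tau> powr p / \<tau>) * indicator {0<..} \<tau> \<le>
      ennreal C1 * (\<integral>\<^sup>+s. k \<tau> s * H s \<partial>lebesgue) +
        ennreal c * (ennreal C1 * I) * (ennreal (\<tau> powr (p - d - 1)) * indicator {0<..<\<tau>0} \<tau>)"
    proof (cases "\<tau> < \<tau>0")
      case True
      then show ?thesis using small[of \<tau>]
        by (auto simp: W_def G_def kstar_inverse split: split_indicator intro: add_increasing)
    next
      case False
      then show ?thesis using large[of \<tau>] \<tau>0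
        by (auto simp: W_def G_def kstar_inverse split: split_indicator intro: add_increasing2)
    qed
  qed
  also have "\<dots> = ennreal C1 * (\<integral>\<^sup>+s. (\<integral>\<^sup>+\<tau>. k \<tau> s \<partial>lborel) * H s \<partial>lebesgue)
     + ennreal c * (ennreal C1 * I) * (\<integral>\<^sup>+\<tau>. ennreal (\<tau> powr (p - d - 1)) * indicator {0<..<\<tau>0} \<tau> \<partial>lborel)"
    using Tn by (subst nn_integral_add) (auto simp: nn_integral_cmult)
  also have "(\<integral>\<^sup>+\<tau>. ennreal (\<tau> powr (p - d - 1)) * indicator {0<..<\<tau>0} \<tau> \<partial>lborel) = ennreal (\<tau>0 powr (p - d) / (p - d))"
    using d \<tau>0 by (intro nn_integral_powr_0) auto
  also have "(\<integral>\<^sup>+s. (\<integral>\<^sup>+\<tau>. k \<tau> s \<partial>lborel) * H s \<partial>lebesgue) \<le> (\<integral>\<^sup>+s. ennreal (M powr a / a) * H s \<partial>lebesgue)"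
  proof (intro nn_integral_mono mult_right_mono)
    fix s
    show "(\<integral>\<^sup>+\<tau>. k \<tau> s \<partial>lborel) \<le> ennreal (M powr a / a)"
    proof (cases "0 < s")
      case True
      have ks: "0 < \<kappa> s" by (rule kappa_pos) fact
      have "(\<integral>\<^sup>+\<tau>. k \<tau> s \<partial>lborel) = (\<integral>\<^sup>+\<tau>. ennreal ((M / \<kappa> s) powr a) * (ennreal (\<tau> powr (a - 1)) * indicator {0<..<\<kappa> s} \<tau>) \<partial>lborel)"
      proof (rule nn_integral_cong)
        fix \<tau>
        have "(M * \<tau> / \<kappa> s) powr a / \<tau> = (M / \<kappa> s) powr a * \<tau> powr (a - 1)" if "0 < \<tau>"
          using that M ks by (simp add: powr_mult powr_divide powr_diff)
        then show "k \<tau> s = ennreal ((M / \<kappa> s) powr a) * (ennreal (\<tau> powr (a - 1)) * indicator {0<..<\<kappa> s} \<tau>)"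
          using True by (auto simp: k_def ennreal_mult split: split_indicator)
      qed
      also have "\<dots> = ennreal ((M / \<kappa> s) powr a) * ennreal (\<kappa> s powr a / a)"
      proof -
        have "(\<integral>\<^sup>+\<tau>. ennreal (\<tau> powr (a - 1)) * indicator {0<..<\<kappa> s} \<tau> \<partial>lborel) = ennreal (\<kappa> s powr a / a)"
          using a ks by (intro nn_integral_powr_0) auto
        then show ?thesis by (subst nn_integral_cmult) auto
      qed
      also have "\<dots> = ennreal (M powr a / a)"
        using M a ks by (simp add: powr_divide flip: ennreal_mult)
      finally show ?thesis by simp
    qed (simp add: k_def)
  qed simp
  also have "\<dots> = ennreal (M powr a / a) * I" unfolding I_def by (rule nn_integral_cmult) measurable
  also have "ennreal C1 * (ennreal (M powr a / a) * I) + ennreal c * (ennreal C1 * I) * ennreal (\<tau>0 powr (p - d) / (p - d))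
    = ennreal (C1 * (M powr a / a) + c * C1 * (\<tau>0 powr (p - d) / (p - d))) * I"
  proof -
    have "ennreal C1 * (ennreal x * I) + ennreal c * (ennreal C1 * I) * ennreal y = ennreal (C1 * x + c * C1 * y) * I"
      if "0 \<le> x" "0 \<le> y" for x y
      using that C1 c by (simp add: ennreal_mult distrib_right distrib_left mult_ac)
    then show ?thesis using a d by simp
  qed
  also have "C1 * (M powr a / a) + c * C1 * (\<tau>0 powr (p - d) / (p - d)) = C1 * (M powr a / a + L * D powr p * \<kappa> T powr p / (p - d))"
  proof -
    have "c * C1 * (\<tau>0 powr (p - d) / (p - d)) = C1 * (L * D powr p * (\<tau>0 powr d * \<tau>0 powr (p - d)) / (p - d))"
      by (simp add: c_def mult_ac)
    also have "\<tau>0 powr d * \<tau>0 powr (p - d) = \<kappa> T powr p"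
      by (simp add: \<tau>0_def flip: powr_add)
    finally show ?thesis by (simp add: distrib_left)
  qed
  finally show ?thesis
    unfolding I_def H_def by (simp add: mult_left_mono)
qed

end

section \<open>The trace estimate\<close>

lemma epowr_mono: "x \<le> y \<Longrightarrow> 0 \<le> a \<Longrightarrow> epowr x a \<le> epowr y a"
  by (auto simp: epowr_def less_top[symmetric] top_unique intro!: ennreal_leI powr_mono2 enn2real_mono)

lemma epowr_root:
  assumes "0 < p" "epowr x (1 / p) < top"
  shows "ennreal (enn2real (epowr x (1 / p)) powr p) = x"
  using assms by (auto simp: epowr_def powr_powr less_top split: if_splits)

lemma sum_powr_integral_bound:
  fixes U F w :: "real \<Rightarrow> real"
  assumes p: "1 < p" and m: "U \<in> borel_measurable lebesgue" "F \<in> borel_measurable lebesgue" "w \<in> borel_measurable lebesgue"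
    and nn: "\<And>x. 0 \<le> U x" "\<And>x. 0 \<le> F x" "\<And>x. 0 \<le> w x"
    and U: "(\<integral>\<^sup>+s. ennreal (U s powr p * w s) \<partial>lebesgue) = ennreal (a powr p)" "0 \<le> a"
    and F: "(\<integral>\<^sup>+s. ennreal (F s powr p * w s) \<partial>lebesgue) = ennreal (b powr p)" "0 \<le> b"
  shows "(\<integral>\<^sup>+s. ennreal ((U s + F s) powr p * w s) \<partial>lebesgue) \<le> ennreal ((4 * (a + b)) powr p)"
proof -
  note [measurable] = m
  have ptw: "(x + y) powr p \<le> 2 powr p * (x powr p + y powr p)" if "0 \<le> x" "0 \<le> y" for x y :: real
  proof -
    have "(x + y) powr p \<le> (2 * max x y) powr p" using that p by (intro powr_mono2) auto
    also have "\<dots> = 2 powr p * max x y powr p" by (simp add: powr_mult)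
    also have "\<dots> \<le> 2 powr p * (x powr p + y powr p)" by (intro mult_left_mono) (auto simp: max_def)
    finally show ?thesis .
  qed
  have "(\<integral>\<^sup>+s. ennreal ((U s + F s) powr p * w s) \<partial>lebesgue)
    \<le> (\<integral>\<^sup>+s. ennreal (2 powr p) * (ennreal (U s powr p * w s) + ennreal (F s powr p * w s)) \<partial>lebesgue)"
  proof (rule nn_integral_mono)
    fix s
    have "(U s + F s) powr p * w s \<le> 2 powr p * (U s powr p + F s powr p) * w s"
      by (intro mult_right_mono ptw nn)
    also have "\<dots> = 2 powr p * (U s powr p * w s + F s powr p * w s)" by (simp add: algebra_simps)
    finally show "ennreal ((U s + F s) powr p * w s) \<le> ennreal (2 powr p) * (ennreal (U s powr p * w s) + ennreal (F s powr p * w s))"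
      using nn by (simp add: ennreal_leI flip: ennreal_plus ennreal_mult)
  qed
  also have "\<dots> = ennreal (2 powr p) * (ennreal (a powr p) + ennreal (b powr p))"
    by (simp add: nn_integral_cmult nn_integral_add U F)
  also have "\<dots> = ennreal (2 powr p * (a powr p + b powr p))" by (simp flip: ennreal_plus ennreal_mult)
  also have "\<dots> \<le> ennreal ((4 * (a + b)) powr p)"
  proof (rule ennreal_leI)
    have "a powr p + b powr p \<le> (a + b) powr p + (a + b) powr p"
      using U F p by (intro add_mono powr_mono2) auto
    also have "\<dots> = 2 powr 1 * (a + b) powr p" by simp
    also have "\<dots> \<le> 2 powr p * (a + b) powr p" using p by (intro mult_right_mono powr_mono) auto
    finally have "2 powr p * (a powr p + b powr p) \<le> 2 powr p * (2 powr p * (a + b) powr p)"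
      by (intro mult_left_mono) auto
    also have "\<dots> = (2 * (2 * (a + b))) powr p" by (simp only: powr_mult)
    finally show "2 powr p * (a powr p + b powr p) \<le> (4 * (a + b)) powr p" by simp
  qed
  finally show ?thesis .
qed

text \<open>
  The factor \<open>4\<close> in front of \<open>N\<close> comes from estimating the norm of the sum of \<open>n0 (u s)\<close> and \<open>n1 (f s)\<close>; all
  other factors are those of \<open>weighted_interpolation_integral\<close>.
\<close>

lemma (in kernel_and_couple) trace_estimate:
  assumes p: "1 < p" and T: "0 < T" and emb: "\<And>a. a \<in> X0 \<Longrightarrow> n1 a \<le> C * n0 a"
    and w: "w \<in> Ap p" and A: "Ap_const p w \<le> ennreal A" "0 < A"
    and \<Phi>: "primitive w \<circ> kstar \<kappa> \<in> I_o 0 p"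
    and \<Lambda>: "1 < \<Lambda>" "s_fun (primitive w \<circ> kstar \<kappa>) \<Lambda> \<le> ennreal (1 / 2 * \<Lambda> powr p)"
    and M: "1 \<le> M" and \<kappa>g: "\<And>r t. 0 < r \<Longrightarrow> r \<le> t \<Longrightarrow> \<kappa> r \<le> M * (t / r) * \<kappa> t"
    and u: "u \<in> Lp_space p T w X0 n0" and f: "f \<in> Lp_space p T w X1 n1" and u0: "u0 \<in> X1"
    and eq: "AE t in lebesgue_on {0<..<T}. \<exists>x.
        has_bochner_integral_on X1 n1 (lebesgue_on {0<..<t}) (\<lambda>s. \<kappa> (t - s) *\<^sub>R (u s - u0)) x \<and>
        has_bochner_integral_on X1 n1 (lebesgue_on {0<..<t}) f x"
    and d_def: "d = p - log \<Lambda> 2" and a_def: "a = (p - d) / 2" and L_def: "L = \<Lambda> powr d"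
    and D_def: "D = max \<bar>C\<bar> (1 / \<kappa> T)"
    and N_def: "N = 4 * (4 powr p * (2 powr (p - 1) * A * (L * (2 * M) powr d)) * (M powr a / a + L * D powr p * \<kappa> T powr p / (p - d))) powr (1 / p)"
  shows "interp_norm (\<lambda>t. primitive w (kstar \<kappa> t) powr (1 / p)) p X0 n0 X1 n1 u0
       \<le> ennreal N * (Lp_norm p T w n0 u + Lp_norm p T w n1 f)"
proof -
  let ?\<Phi> = "\<lambda>x. primitive w (kstar \<kappa> x)"
  define N0 where "N0 = 4 powr p * (2 powr (p - 1) * A * (L * (2 * M) powr d)) * (M powr a / a + L * D powr p * \<kappa> T powr p / (p - d))"
  have w': "w \<in> borel_measurable lebesgue" "\<And>x. 0 \<le> w x" "AE x in lebesgue. 0 < w x"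
    using w by (auto simp: Ap_def)
  have \<Phi>pos: "0 < ?\<Phi> x" if "0 < x" for x
    using I_o_pos[OF \<Phi> that] by simp
  have \<Phi>mono: "?\<Phi> x \<le> ?\<Phi> y" if "0 < x" "x \<le> y" for x y
    using primitive_mono[OF w'(1,2) \<Phi>pos[of y] kstar_mono[OF that] order_refl] that by simp
  have \<Phi>step: "?\<Phi> (\<Lambda> * x) \<le> \<Lambda> powr p / 2 * ?\<Phi> x" if "0 < x" for x
    using \<Lambda> that \<Phi>pos s_fun_le_iff[of "primitive w \<circ> kstar \<kappa>" "1 / 2 * \<Lambda> powr p" \<Lambda>] by auto
  have d: "0 \<le> d" "d < p"
    using power_growth(1)[of ?\<Phi>, OF \<Phi>mono \<Phi>pos \<Lambda>(1) \<Phi>step d_def] \<Lambda>(1) by (auto simp: d_def)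
  have L: "0 < L" using \<Lambda> by (simp add: L_def)
  have kT: "0 < \<kappa> T" using T by (rule kappa_pos)
  have D: "0 < D" using kT by (simp add: D_def less_max_iff_disj)
  have a: "0 < a" using d by (simp add: a_def)
  have N0: "0 \<le> N0" using A L M a d by (simp add: N0_def)
  have sm: "strongly_measurable_on X0 n0 (lebesgue_on {0<..<T}) u" "strongly_measurable_on X1 n1 (lebesgue_on {0<..<T}) f"
    and fin: "Lp_norm p T w n0 u < top" "Lp_norm p T w n1 f < top"
    using u f by (auto simp: Lp_space_def)
  have uX: "u s \<in> X0" "f s \<in> X1" if "s \<in> {0<..<T}" for s
    using sm that by (auto simp: strongly_measurable_on_def space_restrict_space)
  define U where "U s = indicator {0<..<T} s * n0 (u s)" for s
  define F where "F s = indicator {0<..<T} s * n1 (f s)" for s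
  have comp: "complete_measure (lebesgue_on {0<..<T})" by (rule complete_measure_lebesgue_on) simp
  have um: "(\<lambda>s. n0 (u s)) \<in> borel_measurable (lebesgue_on {0<..<T})"
    and fm: "(\<lambda>s. n1 (f s)) \<in> borel_measurable (lebesgue_on {0<..<T})"
    using strongly_measurable_on_norm[OF n0 comp sm(1)] strongly_measurable_on_norm[OF n1 comp sm(2)] .
  have UF: "U \<in> borel_measurable lebesgue" "F \<in> borel_measurable lebesgue"
    using um fm unfolding U_def F_def by (simp_all add: borel_measurable_restrict_space_iff)
  have UF0: "0 \<le> U s" "0 \<le> F s" for s
    using uX norm_on_nonneg[OF n0] norm_on_nonneg[OF n1] by (auto simp: U_def F_def split: split_indicator)
  define x y where "x = enn2real (Lp_norm p T w n0 u)" and "y = enn2real (Lp_norm p T w n1 f)"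
  have xy: "0 \<le> x" "0 \<le> y" "Lp_norm p T w n0 u = ennreal x" "Lp_norm p T w n1 f = ennreal y"
    using fin by (auto simp: x_def y_def)
  have IU: "(\<integral>\<^sup>+s. ennreal (U s powr p * w s) \<partial>lebesgue) = ennreal (x powr p)"
  proof -
    have "ennreal (x powr p) = (\<integral>\<^sup>+t. ennreal (n0 (u t) powr p * w t) \<partial>lebesgue_on {0<..<T})"
      unfolding x_def Lp_norm_def by (rule epowr_root) (use fin p in \<open>auto simp: Lp_norm_def\<close>)
    also have "\<dots> = (\<integral>\<^sup>+s. ennreal (U s powr p * w s) \<partial>lebesgue)"
      by (subst nn_integral_restrict_space) (auto simp: U_def intro!: nn_integral_cong split: split_indicator)
    finally show ?thesis by simp
  qed
  have IF: "(\<integral>\<^sup>+s. ennreal (F s powr p * w s) \<partial>lebesgue) = ennreal (y powr p)"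
  proof -
    have "ennreal (y powr p) = (\<integral>\<^sup>+t. ennreal (n1 (f t) powr p * w t) \<partial>lebesgue_on {0<..<T})"
      unfolding y_def Lp_norm_def by (rule epowr_root) (use fin p in \<open>auto simp: Lp_norm_def\<close>)
    also have "\<dots> = (\<integral>\<^sup>+s. ennreal (F s powr p * w s) \<partial>lebesgue)"
      by (subst nn_integral_restrict_space) (auto simp: F_def intro!: nn_integral_cong split: split_indicator)
    finally show ?thesis by simp
  qed
  have Kbound: "ennreal (gen_inverse \<kappa> \<tau> / 4 * K \<tau> u0) \<le> (\<integral>\<^sup>+s. ennreal (U s + F s) * indicator {0<..<gen_inverse \<kappa> \<tau>} s \<partial>lebesgue)"
    if \<tau>: "0 < \<tau>" "gen_inverse \<kappa> \<tau> \<le> T" for \<tau>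
  proof -
    have "ennreal (gen_inverse \<kappa> \<tau> / 4) * ennreal (K \<tau> u0)
      \<le> (\<integral>\<^sup>+s. (ennreal (U s) + ennreal (F s)) * indicator {0<..<gen_inverse \<kappa> \<tau>} s \<partial>lebesgue)"
    proof (rule average_convolution_bound[OF \<tau>(1) refl \<tau>(2)])
      show "AE x in lebesgue_on {0<..<T}. ennreal (K \<tau> u0) * kint x \<le>
        (\<integral>\<^sup>+s. ennreal (\<kappa> (x - s)) * indicator {0<..<x} s * ennreal (U s) \<partial>lebesgue) +
        ennreal \<tau> * (\<integral>\<^sup>+s. ennreal (F s) * indicator {0<..<x} s \<partial>lebesgue)"
        using eq AE_space
      proof eventually_elim
        case (elim x)
        then have x: "0 < x" "x < T" by (auto simp: space_restrict_space)
        from elim obtain z where z: "has_bochner_integral_on X1 n1 (lebesgue_on {0<..<x}) (\<lambda>s. \<kappa> (x - s) *\<^sub>R (u s - u0)) z"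
          "has_bochner_integral_on X1 n1 (lebesgue_on {0<..<x}) f z" by blast
        have "(\<lambda>s. n0 (u s)) \<in> borel_measurable (lebesgue_on {0<..<x})"
          using x by (intro measurable_restrict_mono[OF um]) auto
        then have "ennreal (K \<tau> u0) * kint x \<le>
          (\<integral>\<^sup>+s. ennreal (\<kappa> (x - s)) * indicator {0<..<x} s * ennreal (n0 (u s)) \<partial>lebesgue) +
          ennreal \<tau> * (\<integral>\<^sup>+s. ennreal (n1 (f s)) * indicator {0<..<x} s \<partial>lebesgue)"
          using x uX by (intro convolution_K_bound[OF x(1) \<tau>(1) _ _ u0 z]) auto
        also have "(\<integral>\<^sup>+s. ennreal (\<kappa> (x - s)) * indicator {0<..<x} s * ennreal (n0 (u s)) \<partial>lebesgue)
          = (\<integral>\<^sup>+s. ennreal (\<kappa> (x - s)) * indicator {0<..<x} s * ennreal (U s) \<partial>lebesgue)"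
          using x by (intro nn_integral_cong) (auto simp: U_def split: split_indicator)
        also have "(\<integral>\<^sup>+s. ennreal (n1 (f s)) * indicator {0<..<x} s \<partial>lebesgue)
          = (\<integral>\<^sup>+s. ennreal (F s) * indicator {0<..<x} s \<partial>lebesgue)"
          using x by (intro nn_integral_cong) (auto simp: F_def split: split_indicator)
        finally show ?case .
      qed
    qed (use UF in measurable)
    then show ?thesis
      using gen_inverse_pos[OF \<tau>(1)] K_nonneg[of \<tau> u0] \<tau> u0 UF0
      by (simp add: ennreal_mult del: times_divide_eq_left)
  qed
  have KD: "K \<tau> u0 \<le> \<tau> * D * K (\<kappa> T) u0" if "0 < \<tau>" for \<tau>
  proof -
    have "K \<tau> u0 \<le> \<tau> * n1 u0" using that u0 by (intro K_le_n1) auto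
    also have "\<dots> \<le> \<tau> * (D * K (\<kappa> T) u0)"
      unfolding D_def using that by (intro mult_left_mono n1_le_K[OF emb kT u0]) auto
    finally show ?thesis by (simp add: mult.assoc)
  qed
  have "(\<integral>\<^sup>+\<tau>\<in>{0<..}. ennreal (?\<Phi> (1 / \<tau>) * K \<tau> u0 powr p / \<tau>) \<partial>lebesgue)
    \<le> ennreal N0 * (\<integral>\<^sup>+s. ennreal ((U s + F s) powr p * w s) * indicator {0<..<T} s \<partial>lebesgue)"
    unfolding N0_def
  proof (rule weighted_interpolation_integral[OF p T w' A _ _ \<Phi>pos _ L d M \<kappa>g _ Kbound D KD a_def refl])
    show "(\<lambda>s. U s + F s) \<in> borel_measurable lebesgue" using UF by measurable
    show "0 \<le> U s + F s" for s using UF0 by (simp add: add_nonneg_nonneg)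
    show "?\<Phi> y \<le> L * (y / x) powr d * ?\<Phi> x" if "0 < x" "x \<le> y" for x y
      unfolding L_def
      by (rule power_growth(2)[of ?\<Phi>, OF \<Phi>mono \<Phi>pos \<Lambda>(1) \<Phi>step d_def that])
    show "0 \<le> K \<tau> u0" if "0 < \<tau>" for \<tau> using that u0 by (intro K_nonneg) auto
  qed
  also have "\<dots> \<le> ennreal N0 * (\<integral>\<^sup>+s. ennreal ((U s + F s) powr p * w s) \<partial>lebesgue)"
    by (intro mult_left_mono nn_integral_mono) (auto split: split_indicator)
  also have "\<dots> \<le> ennreal N0 * ennreal ((4 * (x + y)) powr p)"
    by (intro mult_left_mono sum_powr_integral_bound[OF p UF w'(1) UF0 w'(2) IU xy(1) IF xy(2)]) simp
  also have "\<dots> = ennreal (N0 * (4 * (x + y)) powr p)" using N0 by (simp flip: ennreal_mult)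
  finally have int: "(\<integral>\<^sup>+\<tau>\<in>{0<..}. ennreal (?\<Phi> (1 / \<tau>) * K \<tau> u0 powr p / \<tau>) \<partial>lebesgue) \<le> ennreal (N0 * (4 * (x + y)) powr p)" .
  have "interp_norm (\<lambda>t. ?\<Phi> t powr (1 / p)) p X0 n0 X1 n1 u0
     = epowr (\<integral>\<^sup>+\<tau>\<in>{0<..}. ennreal (?\<Phi> (1 / \<tau>) * K \<tau> u0 powr p / \<tau>) \<partial>lebesgue) (1 / p)"
  proof -
    have "(?\<Phi> (1 / \<tau>) powr (1 / p) * K \<tau> u0) powr p = ?\<Phi> (1 / \<tau>) * K \<tau> u0 powr p" if "0 < \<tau>" for \<tau>
      using \<Phi>pos[of "1 / \<tau>"] that p by (simp add: powr_mult powr_powr)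
    then show ?thesis
      unfolding interp_norm_def K_def[symmetric]
      by (intro arg_cong2[where f = epowr] nn_integral_cong refl) (auto split: split_indicator)
  qed
  also have "\<dots> \<le> epowr (ennreal (N0 * (4 * (x + y)) powr p)) (1 / p)"
    using p by (intro epowr_mono int) auto
  also have "\<dots> = ennreal (N0 powr (1 / p) * (4 * (x + y)))"
    using N0 xy p by (simp add: epowr_def powr_mult powr_powr)
  also have "N0 powr (1 / p) * (4 * (x + y)) = N * (x + y)" by (simp add: N_def N0_def)
  also have "ennreal (N * (x + y)) = ennreal N * (ennreal x + ennreal y)"
    using xy by (simp add: N_def ennreal_mult flip: ennreal_plus)
  finally show ?thesis by (simp add: xy)
qed

theorem theorem5p3:
  fixes p T C :: real and \<kappa> :: "real \<Rightarrow> real" and A :: ennreal and \<sigma> :: "real \<Rightarrow> ennreal"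
  assumes "1 < p" and "0 < T"
    and "\<forall>t>0. continuous (at_right t) \<kappa>"
    and "antimono_on {0<..} \<kappa>"
    and "\<kappa> \<in> I_o (- 1) 0"
  shows "\<exists>N::real. \<forall>(X0 :: 'v::real_vector set) n0 X1 n1 w u f u0.
     banach_on X0 n0 \<and> banach_on X1 n1 \<and> X0 \<subseteq> X1 \<and> (\<forall>a\<in>X0. n1 a \<le> C * n0 a) \<and>
     w \<in> Ap p \<and> Ap_const p w = A \<and>
     primitive w \<circ> kstar \<kappa> \<in> I_o 0 p \<and> (\<forall>r>0. s_fun (primitive w \<circ> kstar \<kappa>) r = \<sigma> r) \<and>
     u \<in> Lp_space p T w X0 n0 \<and> f \<in> Lp_space p T w X1 n1 \<and> u0 \<in> X1 \<and>
     (AE t in lebesgue_on {0<..<T}. \<exists>x.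
        has_bochner_integral_on X1 n1 (lebesgue_on {0<..<t}) (\<lambda>s. \<kappa> (t - s) *\<^sub>R (u s - u0)) x \<and>
        has_bochner_integral_on X1 n1 (lebesgue_on {0<..<t}) f x)
     \<longrightarrow>
     u0 \<in> interp_space (\<lambda>t. primitive w (kstar \<kappa> t) powr (1 / p)) p X0 n0 X1 n1 \<and>
     interp_norm (\<lambda>t. primitive w (kstar \<kappa> t) powr (1 / p)) p X0 n0 X1 n1 u0
       \<le> ennreal N * (Lp_norm p T w n0 u + Lp_norm p T w n1 f)"
proof -
  interpret convolution_kernel \<kappa> by unfold_locales fact+
  obtain M e where M: "1 \<le> M" and e: "0 \<le> e" "e < 1"
    and growth: "\<And>r t. 0 < r \<Longrightarrow> r \<le> t \<Longrightarrow> \<kappa> r \<le> M * (t / r) powr e * \<kappa> t"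
    using kappa_growth by blast
  have \<kappa>g: "\<kappa> r \<le> M * (t / r) * \<kappa> t" if "0 < r" "r \<le> t" for r t
  proof -
    have "(t / r) powr e \<le> (t / r) powr 1" using that e by (intro powr_mono) auto
    then have "M * (t / r) powr e * \<kappa> t \<le> M * (t / r) * \<kappa> t"
      using that M kappa_pos[of t] by (intro mult_right_mono mult_left_mono) auto
    then show ?thesis using growth[OF that] by simp
  qed
  \<comment> \<open>the dilation factor is chosen from \<open>\<sigma>\<close> alone, so that the constants below do not depend on the
    weight; it exists as soon as some weight satisfies the hypotheses\<close>
  define \<Lambda> where "\<Lambda> = (SOME r. 1 < r \<and> \<sigma> r \<le> ennreal (1 / 2 * r powr p))"
  \<comment> \<open>the summand \<open>1\<close> makes \<open>A'\<close> positive\<close>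
  define A' where "A' = enn2real A + 1"
  define d where "d = p - log \<Lambda> 2"
  define a where "a = (p - d) / 2"
  define L where "L = \<Lambda> powr d"
  define D where "D = max \<bar>C\<bar> (1 / \<kappa> T)"
  define N where "N = 4 * (4 powr p * (2 powr (p - 1) * A' * (L * (2 * M) powr d)) * (M powr a / a + L * D powr p * \<kappa> T powr p / (p - d))) powr (1 / p)"
  show ?thesis
  proof (intro exI[of _ N] allI impI, elim conjE)
    fix X0 :: "'v set" and n0 X1 n1 w u f u0
    assume X: "banach_on X0 n0" "banach_on X1 n1" "X0 \<subseteq> X1" and emb: "\<forall>a\<in>X0. n1 a \<le> C * n0 a"
      and w: "w \<in> Ap p" "Ap_const p w = A"
      and \<Phi>: "primitive w \<circ> kstar \<kappa> \<in> I_o 0 p" and \<sigma>: "\<forall>r>0. s_fun (primitive w \<circ> kstar \<kappa>) r = \<sigma> r"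
      and uf: "u \<in> Lp_space p T w X0 n0" "f \<in> Lp_space p T w X1 n1" "u0 \<in> X1"
      and eq: "AE t in lebesgue_on {0<..<T}. \<exists>x.
        has_bochner_integral_on X1 n1 (lebesgue_on {0<..<t}) (\<lambda>s. \<kappa> (t - s) *\<^sub>R (u s - u0)) x \<and>
        has_bochner_integral_on X1 n1 (lebesgue_on {0<..<t}) f x"
    interpret kernel_and_couple \<kappa> X0 n0 X1 n1
      by unfold_locales (use X in \<open>auto simp: banach_on_def\<close>)
    have "\<exists>r>1. s_fun (primitive w \<circ> kstar \<kappa>) r \<le> ennreal (1 / 2 * r powr p)"
      by (rule I_o_small_at_top[OF \<Phi>]) simp
    then have "\<exists>r. 1 < r \<and> \<sigma> r \<le> ennreal (1 / 2 * r powr p)"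
      using \<sigma> by (metis less_trans zero_less_one)
    then have "1 < \<Lambda> \<and> \<sigma> \<Lambda> \<le> ennreal (1 / 2 * \<Lambda> powr p)"
      unfolding \<Lambda>_def by (rule someI_ex)
    then have \<Lambda>: "1 < \<Lambda>" "s_fun (primitive w \<circ> kstar \<kappa>) \<Lambda> \<le> ennreal (1 / 2 * \<Lambda> powr p)"
      using \<sigma> by auto
    have "A < top" using w by (auto simp: Ap_def)
    then have A: "Ap_const p w \<le> ennreal A'" "0 < A'"
      using w by (auto simp: A'_def add_nonneg_pos ennreal_plus)
    have est: "interp_norm (\<lambda>t. primitive w (kstar \<kappa> t) powr (1 / p)) p X0 n0 X1 n1 u0
       \<le> ennreal N * (Lp_norm p T w n0 u + Lp_norm p T w n1 f)"
      using emb
      by (intro trace_estimate[OF assms(1,2) _ w(1) A \<Phi> \<Lambda> M \<kappa>g uf eq d_def a_def L_def D_def N_def]) auto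
    have "Lp_norm p T w n0 u < top" "Lp_norm p T w n1 f < top"
      using uf by (auto simp: Lp_space_def)
    then have "ennreal N * (Lp_norm p T w n0 u + Lp_norm p T w n1 f) < top"
      by (simp add: ennreal_mult_less_top)
    with est have "interp_norm (\<lambda>t. primitive w (kstar \<kappa> t) powr (1 / p)) p X0 n0 X1 n1 u0 < top"
      by (rule le_less_trans)
    moreover have "\<exists>a0\<in>X0. \<exists>a1\<in>X1. u0 = a0 + a1"
      using uf(3) subspace_0[OF norm_on_subspace[OF n0]] by (metis add_0)
    ultimately show "u0 \<in> interp_space (\<lambda>t. primitive w (kstar \<kappa> t) powr (1 / p)) p X0 n0 X1 n1 \<and>
      interp_norm (\<lambda>t. primitive w (kstar \<kappa> t) powr (1 / p)) p X0 n0 X1 n1 u0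
       \<le> ennreal N * (Lp_norm p T w n0 u + Lp_norm p T w n1 f)"
      using est by (simp add: interp_space_def)
  qed
qed

end
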